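(* Let $W=(\tau,d,v,(m_{A,I}))$ be a smooth solution on $[0,T]\times\mathbb{R}^n$ of the system (N) displayed in the context, with $\tau>0$. Set $F_{\alpha i}=\tau^{-1}m_{\{\alpha\},\{i\}}$. If at $t=0$ the constraints $$\tau v_i=\sum_{\alpha}m_{\{\alpha\},\{i\}}d_\alpha\ \ (1\le i\le n),\qquad 1=\sum_\alpha d_\alpha^2+\sum_iv_i^2+\tau^2+\sum_{A,I}m_{A,I}^2,\qquad m_{A,I}=\tau[F]_{A,I}\ \text{ for all }A,I$$ hold on $\mathbb{R}^n$, then they hold on $\mathbb{R}^n$ for all $t\in[0,T]$.
   Context: **Index notation.** $m,n\ge1$, $r=\min\{m,n\}$. Unless otherwise specified, $A$ ranges over subsets of $\{1,\dots,m\}$ and $I$ over subsets of $\{1,\dots,n\}$ with $1\le|A|=|I|\le r$; $\alpha$ ranges over $1,\dots,m$ and $i,j$ over $1,\dots,n$. $O_A(\alpha)$ denotes the rank of $\alpha$ in $A\cup\{\alpha\}$ ($\alpha$ is the $O_A(\alpha)$-th smallest element of $A\cup\{\alpha\}$); similarly $O_I(i)$. For an $m\times n$ matrix $F$, $[F]_{A,I}$ is the minor of $F$ with rows $A$ and columns $I$ (in increasing order). $\partial_i=\partial_{x_i}$. "Smooth solution on $[0,T]\times\mathbb{R}^n$" means a $C^\infty$ solution which is bounded together with its first derivatives. **System (N)**, with the convention $m_{\emptyset,\emptyset}=\tau$: $$\partial_t\tau+\sum_jv_j\partial_j\tau-\tau\sum_j\partial_jv_j=0,$$ $$\partial_td_\alpha+\sum_iv_i\partial_id_\alpha+\sum_{A,I,i:\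 \alpha\in A,\,i\in I}(-1)^{O_A(\alpha)+O_I(i)}m_{A\setminus\{\alpha\},I\setminus\{i\}}\,\partial_im_{A,I}=0,$$ $$\partial_tv_i+\sum_{A,I,j:\ j\in I,\,i\notin I\setminus\{j\}}(-1)^{O_I(j)+O_{I\setminus\{j\}}(i)}m_{A,(I\setminus\{j\})\cup\{i\}}\,\partial_jm_{A,I}-\sum_{A,I}m_{A,I}\partial_im_{A,I}+\sum_jv_j\partial_jv_i-\tau\partial_i\tau=0,$$ $$\partial_tm_{A,I}+\sum_jv_j\partial_jm_{A,I}+\sum_{i,j:\ i\in I,\,j\notin I\setminus\{i\}}(-1)^{O_{I\setminus\{i\}}(j)+O_I(i)}m_{A,(I\setminus\{i\})\cup\{j\}}\,\partial_iv_j-m_{A,I}\sum_j\partial_jv_j+\sum_{\alpha,i:\ \alpha\in A,\,i\in I}(-1)^{O_A(\alpha)+O_I(i)}m_{A\setminus\{\alpha\},I\setminus\{i\}}\,\partial_id_\alpha=0.$$ *)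

theory Defs
  imports "HOL-Analysis.Analysis" "Jordan_Normal_Form.Determinant"
begin

text \<open>
  The index sets \<open>{1,\<dots>,m}\<close> and \<open>{1,\<dots>,n}\<close> are finite linearly ordered types \<open>'m\<close> and \<open>'n\<close>,
  with \<open>m = CARD('m)\<close> and \<open>n = CARD('n)\<close>; only their order matters, through ranks and through
  the order of the rows and columns of a minor. Fields are functions of the
  space-time point \<open>(t, x)\<close>.
\<close>

type_synonym 'n spacetime = "real \<times> (real ^ 'n)"
type_synonym 'n field = "'n spacetime \<Rightarrow> real"


subsection \<open>Smooth functions on a closed slab\<close>

definition slab :: "real \<Rightarrow> 'n::finite spacetime set" where
  "slab T = {0..T} \<times> UNIV"

text \<open>
  Derivatives are taken within \<open>S\<close>, hence are one-sided in time at the faces \<open>t = 0\<close> and \<open>t = T\<close>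
  of a slab. They are uniquely determined on \<open>slab T\<close> when \<open>T > 0\<close>.
\<close>

definition dir_deriv ::
  "'a::real_normed_vector set \<Rightarrow> 'a \<Rightarrow> ('a \<Rightarrow> real) \<Rightarrow> 'a \<Rightarrow> real" where
  "dir_deriv S b f p = frechet_derivative f (at p within S) b"

primrec Ck_on :: "nat \<Rightarrow> 'a::euclidean_space set \<Rightarrow> ('a \<Rightarrow> real) \<Rightarrow> bool" where
  "Ck_on 0 S f \<longleftrightarrow> continuous_on S f"
| "Ck_on (Suc k) S f \<longleftrightarrow> f differentiable_on S \<and> (\<forall>b\<in>Basis. Ck_on k S (dir_deriv S b f))"

definition smooth_on :: "'a::euclidean_space set \<Rightarrow> ('a \<Rightarrow> real) \<Rightarrow> bool" where
  "smooth_on S f \<longleftrightarrow> (\<forall>k. Ck_on k S f)"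

definition smooth_bounded_on :: "'a::euclidean_space set \<Rightarrow> ('a \<Rightarrow> real) \<Rightarrow> bool" where
  "smooth_bounded_on S f \<longleftrightarrow>
     smooth_on S f \<and> bounded (f ` S) \<and> (\<forall>b\<in>Basis. bounded (dir_deriv S b f ` S))"

definition dt :: "real \<Rightarrow> 'n::finite field \<Rightarrow> 'n field" where
  "dt T = dir_deriv (slab T) (1, 0)"

definition dx :: "real \<Rightarrow> 'n \<Rightarrow> 'n::finite field \<Rightarrow> 'n field" where
  "dx T i = dir_deriv (slab T) (0, axis i 1)"


subsection \<open>Minors and ranks\<close>

definition idx :: "('m::finite set \<times> 'n::finite set) set" where
  "idx = {(A, I). card A = card I \<and> 1 \<le> card A \<and> card A \<le> min CARD('m) CARD('n)}"

definition rank_in :: "'k::{finite,linorder} set \<Rightarrow> 'k \<Rightarrow> nat" where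
  "rank_in A a = card {b \<in> A \<union> {a}. b \<le> a}"

definition minor ::
  "('m::{finite,linorder} \<Rightarrow> 'n::{finite,linorder} \<Rightarrow> real) \<Rightarrow> 'm set \<Rightarrow> 'n set \<Rightarrow> real" where
  "minor F A I = Determinant.det (Matrix.mat (card A) (card I)
     (\<lambda>(k, l). F (sorted_list_of_set A ! k) (sorted_list_of_set I ! l)))"


subsection \<open>The system and the constraints\<close>

text \<open>
  The convention \<open>m\<^bsub>\<emptyset>,\<emptyset>\<^esub> = \<tau>\<close>. A family \<open>m\<close> carries data only at the pairs in \<open>idx\<close>.
\<close>

definition mext ::
  "'n::finite field \<Rightarrow> ('m::finite set \<Rightarrow> 'n set \<Rightarrow> 'n field) \<Rightarrow> 'm set \<Rightarrow> 'n set \<Rightarrow> 'n field" where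
  "mext \<tau> m A I = (if A = {} \<and> I = {} then \<tau> else m A I)"

definition tau_eq :: "real \<Rightarrow> 'n::finite field \<Rightarrow> ('n \<Rightarrow> 'n field) \<Rightarrow> 'n spacetime \<Rightarrow> bool" where
  "tau_eq T \<tau> v p \<longleftrightarrow>
     dt T \<tau> p + (\<Sum>j\<in>UNIV. v j p * dx T j \<tau> p) - \<tau> p * (\<Sum>j\<in>UNIV. dx T j (v j) p) = 0"

definition d_eq ::
  "real \<Rightarrow> 'n::{finite,linorder} field \<Rightarrow> ('m::{finite,linorder} \<Rightarrow> 'n field) \<Rightarrow> ('n \<Rightarrow> 'n field)
    \<Rightarrow> ('m set \<Rightarrow> 'n set \<Rightarrow> 'n field) \<Rightarrow> 'm \<Rightarrow> 'n spacetime \<Rightarrow> bool" where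
  "d_eq T \<tau> d v m \<alpha> p \<longleftrightarrow>
     dt T (d \<alpha>) p + (\<Sum>i\<in>UNIV. v i p * dx T i (d \<alpha>) p)
     + (\<Sum>(A, I) | (A, I) \<in> idx \<and> \<alpha> \<in> A. \<Sum>i\<in>I.
          (-1) ^ (rank_in A \<alpha> + rank_in I i)
          * mext \<tau> m (A - {\<alpha>}) (I - {i}) p * dx T i (m A I) p) = 0"

definition v_eq ::
  "real \<Rightarrow> 'n::{finite,linorder} field \<Rightarrow> ('n \<Rightarrow> 'n field)
    \<Rightarrow> ('m::{finite,linorder} set \<Rightarrow> 'n set \<Rightarrow> 'n field) \<Rightarrow> 'n \<Rightarrow> 'n spacetime \<Rightarrow> bool" where
  "v_eq T \<tau> v m i p \<longleftrightarrow>
     dt T (v i) p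
     + (\<Sum>(A, I)\<in>idx. \<Sum>j | j \<in> I \<and> i \<notin> I - {j}.
          (-1) ^ (rank_in I j + rank_in (I - {j}) i)
          * m A ((I - {j}) \<union> {i}) p * dx T j (m A I) p)
     - (\<Sum>(A, I)\<in>idx. m A I p * dx T i (m A I) p)
     + (\<Sum>j\<in>UNIV. v j p * dx T j (v i) p)
     - \<tau> p * dx T i \<tau> p = 0"

definition m_eq ::
  "real \<Rightarrow> 'n::{finite,linorder} field \<Rightarrow> ('m::{finite,linorder} \<Rightarrow> 'n field) \<Rightarrow> ('n \<Rightarrow> 'n field)
    \<Rightarrow> ('m set \<Rightarrow> 'n set \<Rightarrow> 'n field) \<Rightarrow> 'm set \<Rightarrow> 'n set \<Rightarrow> 'n spacetime \<Rightarrow> bool" where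
  "m_eq T \<tau> d v m A I p \<longleftrightarrow>
     dt T (m A I) p + (\<Sum>j\<in>UNIV. v j p * dx T j (m A I) p)
     + (\<Sum>i\<in>I. \<Sum>j | j \<notin> I - {i}.
          (-1) ^ (rank_in (I - {i}) j + rank_in I i)
          * m A ((I - {i}) \<union> {j}) p * dx T i (v j) p)
     - m A I p * (\<Sum>j\<in>UNIV. dx T j (v j) p)
     + (\<Sum>\<alpha>\<in>A. \<Sum>i\<in>I.
          (-1) ^ (rank_in A \<alpha> + rank_in I i)
          * mext \<tau> m (A - {\<alpha>}) (I - {i}) p * dx T i (d \<alpha>) p) = 0"

definition system_N ::
  "real \<Rightarrow> 'n::{finite,linorder} field \<Rightarrow> ('m::{finite,linorder} \<Rightarrow> 'n field) \<Rightarrow> ('n \<Rightarrow> 'n field)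
    \<Rightarrow> ('m set \<Rightarrow> 'n set \<Rightarrow> 'n field) \<Rightarrow> bool" where
  "system_N T \<tau> d v m \<longleftrightarrow>
     (\<forall>p\<in>slab T.
        tau_eq T \<tau> v p \<and> (\<forall>\<alpha>. d_eq T \<tau> d v m \<alpha> p) \<and> (\<forall>i. v_eq T \<tau> v m i p)
        \<and> (\<forall>(A, I)\<in>idx. m_eq T \<tau> d v m A I p))"

definition smooth_solution_N ::
  "real \<Rightarrow> 'n::{finite,linorder} field \<Rightarrow> ('m::{finite,linorder} \<Rightarrow> 'n field) \<Rightarrow> ('n \<Rightarrow> 'n field)
    \<Rightarrow> ('m set \<Rightarrow> 'n set \<Rightarrow> 'n field) \<Rightarrow> bool" where
  "smooth_solution_N T \<tau> d v m \<longleftrightarrow>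
     smooth_bounded_on (slab T) \<tau>
     \<and> (\<forall>\<alpha>. smooth_bounded_on (slab T) (d \<alpha>))
     \<and> (\<forall>i. smooth_bounded_on (slab T) (v i))
     \<and> (\<forall>(A, I)\<in>idx. smooth_bounded_on (slab T) (m A I))
     \<and> system_N T \<tau> d v m"

definition constraints ::
  "'n::{finite,linorder} field \<Rightarrow> ('m::{finite,linorder} \<Rightarrow> 'n field) \<Rightarrow> ('n \<Rightarrow> 'n field)
    \<Rightarrow> ('m set \<Rightarrow> 'n set \<Rightarrow> 'n field) \<Rightarrow> 'n spacetime \<Rightarrow> bool" where
  "constraints \<tau> d v m p \<longleftrightarrow>
     (\<forall>i. \<tau> p * v i p = (\<Sum>\<alpha>\<in>UNIV. m {\<alpha>} {i} p * d \<alpha> p))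
     \<and> 1 = (\<Sum>\<alpha>\<in>UNIV. (d \<alpha> p)\<^sup>2) + (\<Sum>i\<in>UNIV. (v i p)\<^sup>2) + (\<tau> p)\<^sup>2
            + (\<Sum>(A, I)\<in>idx. (m A I p)\<^sup>2)
     \<and> (let F = (\<lambda>\<alpha> i. m {\<alpha>} {i} p / \<tau> p)
        in \<forall>(A, I)\<in>idx. m A I p = \<tau> p * minor F A I)"

end

theory Submission
  imports Defs
begin

text \<open>
  Collect the unknowns \<open>m\<^bsub>A,I\<^esub>\<close>, with \<open>\<tau>\<close> in the slot \<open>(\<emptyset>, \<emptyset>)\<close>, in one vector \<open>\<mu>\<close> indexed by
  pairs of sets. The signs of the system are those of exterior and interior multiplication:
  with \<open>c\<^sub>i\<close>, \<open>c\<^sub>i\<^sup>*\<close> (\<open>ann_col\<close>, \<open>cre_col\<close>) removing or adding the column \<open>i\<close>, and \<open>r\<^sub>\<alpha>\<close>, \<open>r\<^sub>\<alpha>\<^sup>*\<close> the same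
  for rows, the system reads, for \<open>D = \<partial>\<^sub>t + v \<cdot> \<nabla>\<close> and with summation over repeated indices,

  \<open>D \<mu> = (div v) \<mu> - \<partial>\<^sub>i v\<^sub>k c\<^sub>i\<^sup>* c\<^sub>k \<mu> - \<partial>\<^sub>i d\<^sub>\<alpha> r\<^sub>\<alpha>\<^sup>* c\<^sub>i\<^sup>* \<mu>\<close>,

  \<open>D v\<^sub>i = \<langle>\<mu>, \<partial>\<^sub>i \<mu>\<rangle> - \<langle>c\<^sub>j\<^sup>* c\<^sub>i \<mu>, \<partial>\<^sub>j \<mu>\<rangle>\<close>, and \<open>D d\<^sub>\<alpha> = - \<langle>r\<^sub>\<alpha>\<^sup>* c\<^sub>j\<^sup>* \<mu>, \<partial>\<^sub>j \<mu>\<rangle>\<close>.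

  Each constraint is the vanishing of a defect that is polynomial in the unknowns.

  The minors. By Laplace expansion \<open>\<mu>\<close> is \<open>\<tau>\<close> times the vector of all minors of \<open>F\<close> exactly if
  \<open>E\<^sub>j = \<tau> c\<^sub>j \<mu> - m\<^bsub>\<alpha>j\<^esub> r\<^sub>\<alpha>\<^sup>* \<mu>\<close> vanishes for all \<open>j\<close> (\<open>minor_defect_zero_iff\<close>); this contains both the
  expansions and the fact that expansions along a foreign column vanish. The anticommutation
  relations turn the equation for \<open>\<mu>\<close> into a linear homogeneous equation for \<open>(E\<^sub>j)\<close> along the flow of
  \<open>v\<close>, with bounded coefficients (\<open>minor_defect_transport\<close>). Determinants are never differentiated.

  Energy and momentum. Let \<open>\<lambda> = (|d|\<^sup>2 + |v|\<^sup>2 + |\<mu>|\<^sup>2 - 1) / 2\<close> and \<open>z = v\<^sub>i c\<^sub>i\<^sup>* \<mu> - d\<^sub>\<alpha> r\<^sub>\<alpha> \<mu>\<close>. The entries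
  of \<open>z\<close> at \<open>(\<emptyset>, {i})\<close> are \<open>\<tau> v\<^sub>i - m\<^bsub>\<alpha>i\<^esub> d\<^sub>\<alpha>\<close>, and given the minor constraint \<open>z = 0\<close> says no more
  than that these vanish. The system implies (\<open>energy_defect_transport\<close>, \<open>momentum_defect_transport\<close>)

  \<open>D \<lambda> = \<langle>c\<^sub>j\<^sup>* \<mu>, \<partial>\<^sub>j z\<rangle>\<close> and \<open>D z = \<partial>\<^sub>j \<lambda> c\<^sub>j\<^sup>* \<mu> + (bounded linear terms in z)\<close>,

  where the second equation uses the minor constraint. This is a symmetric system, so
  \<open>e = \<lambda>\<^sup>2 + |z|\<^sup>2\<close> satisfies \<open>D e \<le> \<partial>\<^sub>j (2 \<lambda> \<langle>z, c\<^sub>j\<^sup>* \<mu>\<rangle>) + C e\<close> with a flux bounded by a multiple of \<open>e\<close>.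

  In both cases a nonnegative density \<open>e\<close> that is zero at \<open>t = 0\<close> satisfies \<open>\<partial>\<^sub>t e \<le> \<partial>\<^sub>j f\<^sub>j + C e\<close> with
  \<open>|f\<^sub>j| \<le> V e\<close>. Finite propagation speed (\<open>local_energy_uniqueness\<close>) makes it vanish: integrate \<open>e\<close> against a
  weight supported in a backward cone, where the weight decreases fast enough in time to absorb the
  flux, and apply Gronwall's inequality. The estimate is local because nothing decays
  at spatial infinity.
\<close>

no_notation Matrix.vec_index (infixl \<open>$\<close> 100)
no_notation Matrix.scalar_prod (infix \<open>\<bullet>\<close> 70)

section \<open>The Fock space of pairs of index sets\<close>

definition pos_sign :: "'k::{finite,linorder} set \<Rightarrow> 'k \<Rightarrow> real" where
  "pos_sign I j = (-1) ^ card {k \<in> I. k < j}"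

lemma pos_sign_cancel: "pos_sign I j * (pos_sign I j * x) = x"
  by (simp add: pos_sign_def flip: power_mult_distrib mult.assoc)

text \<open>All anticommutation relations below come from these two sign rules.\<close>

lemma pos_sign_insert:
  assumes "i \<notin> I"
  shows "pos_sign (insert i I) j = (if i < j then - pos_sign I j else pos_sign I j)"
proof (cases "i < j")
  case True
  then have "{k \<in> insert i I. k < j} = insert i {k \<in> I. k < j}" by auto
  with assms True show ?thesis by (simp add: pos_sign_def)
next
  case False
  then have "{k \<in> insert i I. k < j} = {k \<in> I. k < j}" by auto
  with False show ?thesis by (simp add: pos_sign_def)
qed

lemma pos_sign_remove:
  assumes "i \<in> I"
  shows "pos_sign (I - {i}) j = (if i < j then - pos_sign I j else pos_sign I j)"
  using pos_sign_insert[of i "I - {i}" j] assms by (auto simp: insert_absorb)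

lemma pos_sign_simps [simp]: "pos_sign {} j = 1" "pos_sign (insert j I) j = pos_sign I j"
  "pos_sign (I - {j}) j = pos_sign I j"
proof -
  show "pos_sign {} j = 1" by (simp add: pos_sign_def)
  have "{k \<in> insert j I. k < j} = {k \<in> I. k < j}" "{k \<in> I - {j}. k < j} = {k \<in> I. k < j}" by auto
  then show "pos_sign (insert j I) j = pos_sign I j" "pos_sign (I - {j}) j = pos_sign I j"
    by (simp_all add: pos_sign_def)
qed

text \<open>
  \<open>rank_in A a\<close> exceeds the number of elements of \<open>A\<close> below \<open>a\<close> by one; the two excesses of a
  product of signs cancel.
\<close>

lemma minus_one_power_rank_in:
  "(-1) ^ (rank_in A a + rank_in I i) = pos_sign A a * pos_sign I i"
proof -
  have rank: "rank_in B b = Suc (card {c \<in> B. c < b})" for B :: "'k::{finite,linorder} set" and b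
  proof -
    have "{c \<in> B \<union> {b}. c \<le> b} = insert b {c \<in> B. c < b}" by auto
    then show ?thesis by (simp add: rank_in_def)
  qed
  show ?thesis by (simp add: rank pos_sign_def power_add)
qed

text \<open>
  The tensor product of the exterior algebras of \<open>\<real>\<^sup>m\<close> and \<open>\<real>\<^sup>n\<close>, in coordinates. The basis vector
  at \<open>(A, I)\<close> is the product of the wedge of the rows in \<open>A\<close> and the wedge of the columns in \<open>I\<close>.
\<close>

type_synonym ('m, 'n) fock = "real ^ ('m set \<times> 'n set)"

text \<open>
  Interior (\<open>ann\<close>) and exterior (\<open>cre\<close>) multiplication by a coordinate vector. Row operators act on
  the first tensor factor alone, without a sign for passing the second: rows and columns commute.
\<close>

definition ann_col :: "'n \<Rightarrow> ('m::{finite,linorder}, 'n::{finite,linorder}) fock \<Rightarrow> ('m, 'n) fock" where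
  "ann_col j x = (\<chi> p. case p of (A, I) \<Rightarrow> if j \<in> I then 0 else pos_sign I j * x $ (A, insert j I))"

definition cre_col :: "'n \<Rightarrow> ('m::{finite,linorder}, 'n::{finite,linorder}) fock \<Rightarrow> ('m, 'n) fock" where
  "cre_col j x = (\<chi> p. case p of (A, I) \<Rightarrow> if j \<in> I then pos_sign I j * x $ (A, I - {j}) else 0)"

definition ann_row :: "'m \<Rightarrow> ('m::{finite,linorder}, 'n::{finite,linorder}) fock \<Rightarrow> ('m, 'n) fock" where
  "ann_row \<alpha> x = (\<chi> p. case p of (A, I) \<Rightarrow> if \<alpha> \<in> A then 0 else pos_sign A \<alpha> * x $ (insert \<alpha> A, I))"

definition cre_row :: "'m \<Rightarrow> ('m::{finite,linorder}, 'n::{finite,linorder}) fock \<Rightarrow> ('m, 'n) fock" where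
  "cre_row \<alpha> x = (\<chi> p. case p of (A, I) \<Rightarrow> if \<alpha> \<in> A then pos_sign A \<alpha> * x $ (A - {\<alpha>}, I) else 0)"

lemma fock_nth:
  "ann_col j x $ (A, I) = (if j \<in> I then 0 else pos_sign I j * x $ (A, insert j I))"
  "cre_col j x $ (A, I) = (if j \<in> I then pos_sign I j * x $ (A, I - {j}) else 0)"
  "ann_row \<alpha> x $ (A, I) = (if \<alpha> \<in> A then 0 else pos_sign A \<alpha> * x $ (insert \<alpha> A, I))"
  "cre_row \<alpha> x $ (A, I) = (if \<alpha> \<in> A then pos_sign A \<alpha> * x $ (A - {\<alpha>}, I) else 0)"
  by (simp_all add: ann_col_def cre_col_def ann_row_def cre_row_def)

lemma fock_eq_iff: "x = y \<longleftrightarrow> (\<forall>A I. x $ (A, I) = y $ (A, I))"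
  for x y :: "('m::finite, 'n::finite) fock"
  by (simp add: Finite_Cartesian_Product.vec_eq_iff)

lemma bounded_linear_fock [bounded_linear]:
  "bounded_linear (ann_col j :: ('m::{finite,linorder}, 'n::{finite,linorder}) fock \<Rightarrow> _)"
  "bounded_linear (cre_col j :: ('m, 'n) fock \<Rightarrow> _)"
  "bounded_linear (ann_row \<alpha> :: ('m, 'n) fock \<Rightarrow> _)"
  "bounded_linear (cre_row \<alpha> :: ('m, 'n) fock \<Rightarrow> _)"
  by (auto intro!: linear_conv_bounded_linear[THEN iffD1] linearI
      simp: fock_eq_iff fock_nth distrib_left)

lemmas linear_fock = bounded_linear_fock[THEN bounded_linear.linear]

lemmas fock_linear_simps =
  linear_fock[THEN linear_add] linear_fock[THEN linear_diff] linear_fock[THEN linear_neg]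
  linear_fock[THEN linear_scale] linear_fock[THEN linear_sum] linear_fock[THEN linear_0]

lemma Diff_right_commute: "A - B - C = A - C - B" for A B C :: "'k set"
  by auto

lemma sum_insert_remove_pairing:
  fixes f g :: "'k::finite set \<Rightarrow> real"
  shows "(\<Sum>I | j \<in> I. f I * g (I - {j})) = (\<Sum>I | j \<notin> I. f (insert j I) * g I)"
  by (rule sum.reindex_bij_witness[where i = "insert j" and j = "\<lambda>I. I - {j}"])
     (auto simp: insert_absorb)

lemma fock_inner: "x \<bullet> y = (\<Sum>A\<in>UNIV. \<Sum>I\<in>UNIV. x $ (A, I) * y $ (A, I))"
  for x y :: "('m::finite, 'n::finite) fock"
  by (simp add: inner_vec_def sum.cartesian_product flip: UNIV_Times_UNIV)

lemma cre_col_adjoint: "cre_col j x \<bullet> y = x \<bullet> ann_col j y"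
proof -
  have "(\<Sum>I\<in>UNIV. cre_col j x $ (A, I) * y $ (A, I)) = (\<Sum>I\<in>UNIV. x $ (A, I) * ann_col j y $ (A, I))"
    for A
  proof -
    have "(\<Sum>I\<in>UNIV. cre_col j x $ (A, I) * y $ (A, I))
        = (\<Sum>I | j \<in> I. (pos_sign I j * y $ (A, I)) * x $ (A, I - {j}))"
      by (rule sum.mono_neutral_cong_right) (auto simp: fock_nth)
    also have "\<dots> = (\<Sum>I | j \<notin> I. (pos_sign (insert j I) j * y $ (A, insert j I)) * x $ (A, I))"
      by (rule sum_insert_remove_pairing)
    also have "\<dots> = (\<Sum>I\<in>UNIV. x $ (A, I) * ann_col j y $ (A, I))"
      by (rule sum.mono_neutral_cong_left) (auto simp: fock_nth)
    finally show ?thesis .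
  qed
  then show ?thesis by (simp add: fock_inner)
qed

lemma cre_row_adjoint: "cre_row \<alpha> x \<bullet> y = x \<bullet> ann_row \<alpha> y"
proof -
  have "(\<Sum>A\<in>UNIV. cre_row \<alpha> x $ (A, I) * y $ (A, I)) = (\<Sum>A\<in>UNIV. x $ (A, I) * ann_row \<alpha> y $ (A, I))"
    for I
  proof -
    have "(\<Sum>A\<in>UNIV. cre_row \<alpha> x $ (A, I) * y $ (A, I))
        = (\<Sum>A | \<alpha> \<in> A. (pos_sign A \<alpha> * y $ (A, I)) * x $ (A - {\<alpha>}, I))"
      by (rule sum.mono_neutral_cong_right) (auto simp: fock_nth)
    also have "\<dots> = (\<Sum>A | \<alpha> \<notin> A. (pos_sign (insert \<alpha> A) \<alpha> * y $ (insert \<alpha> A, I)) * x $ (A, I))"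
      by (rule sum_insert_remove_pairing)
    also have "\<dots> = (\<Sum>A\<in>UNIV. x $ (A, I) * ann_row \<alpha> y $ (A, I))"
      by (rule sum.mono_neutral_cong_left) (auto simp: fock_nth)
    finally show ?thesis .
  qed
  then show ?thesis unfolding fock_inner by (subst (1 2) sum.swap) simp
qed

lemma col_anticommutator: "ann_col i (cre_col j x) + cre_col j (ann_col i x) = (if i = j then x else 0)"
  by (cases i j rule: linorder_cases)
     (auto simp: fock_eq_iff fock_nth pos_sign_insert pos_sign_remove insert_Diff_if insert_absorb
        pos_sign_cancel mult.left_commute)

lemma row_anticommutator: "ann_row \<alpha> (cre_row \<beta> x) + cre_row \<beta> (ann_row \<alpha> x) = (if \<alpha> = \<beta> then x else 0)"
  by (cases \<alpha> \<beta> rule: linorder_cases)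
     (auto simp: fock_eq_iff fock_nth pos_sign_insert pos_sign_remove insert_Diff_if insert_absorb
        pos_sign_cancel mult.left_commute)

lemma ann_col_anticommute: "ann_col i (ann_col j x) = - ann_col j (ann_col i x)"
  by (cases i j rule: linorder_cases)
     (auto simp: fock_eq_iff fock_nth pos_sign_insert insert_commute[of i j] mult.left_commute)

lemma cre_col_anticommute: "cre_col i (cre_col j x) = - cre_col j (cre_col i x)"
  by (cases i j rule: linorder_cases)
     (auto simp: fock_eq_iff fock_nth pos_sign_remove Diff_right_commute[of _ "{i}" "{j}"] mult.left_commute)

lemma cre_row_anticommute: "cre_row \<alpha> (cre_row \<beta> x) = - cre_row \<beta> (cre_row \<alpha> x)"
  by (cases \<alpha> \<beta> rule: linorder_cases)
     (auto simp: fock_eq_iff fock_nth pos_sign_remove Diff_right_commute[of _ "{\<alpha>}" "{\<beta>}"] mult.left_commute)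

lemma row_col_commute:
  "ann_row \<alpha> (ann_col i x) = ann_col i (ann_row \<alpha> x)"
  "ann_row \<alpha> (cre_col i x) = cre_col i (ann_row \<alpha> x)"
  "cre_row \<alpha> (ann_col i x) = ann_col i (cre_row \<alpha> x)"
  "cre_row \<alpha> (cre_col i x) = cre_col i (cre_row \<alpha> x)"
  by (auto simp: fock_eq_iff fock_nth mult.left_commute)

text \<open>
  Taking the inner product of the anticommutation relation with \<open>x\<close> shows that annihilators and
  creators are contractions.
\<close>

lemma norm_ann_cre_col: "(norm (ann_col j x))\<^sup>2 + (norm (cre_col j x))\<^sup>2 = (norm x)\<^sup>2"
proof -
  have "(norm (ann_col j x))\<^sup>2 + (norm (cre_col j x))\<^sup>2
      = (ann_col j (cre_col j x) + cre_col j (ann_col j x)) \<bullet> x"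
    by (simp add: power2_norm_eq_inner inner_add_left cre_col_adjoint)
       (metis cre_col_adjoint inner_commute)
  then show ?thesis by (simp add: col_anticommutator power2_norm_eq_inner)
qed

lemma norm_ann_cre_row: "(norm (ann_row \<alpha> x))\<^sup>2 + (norm (cre_row \<alpha> x))\<^sup>2 = (norm x)\<^sup>2"
proof -
  have "(norm (ann_row \<alpha> x))\<^sup>2 + (norm (cre_row \<alpha> x))\<^sup>2
      = (ann_row \<alpha> (cre_row \<alpha> x) + cre_row \<alpha> (ann_row \<alpha> x)) \<bullet> x"
    by (simp add: power2_norm_eq_inner inner_add_left cre_row_adjoint)
       (metis cre_row_adjoint inner_commute)
  then show ?thesis by (simp add: row_anticommutator power2_norm_eq_inner)
qed

lemma norm_fock_le:
  "norm (ann_col j x) \<le> norm x" "norm (cre_col j x) \<le> norm x" "norm (cre_row \<alpha> x) \<le> norm x"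
  using norm_ann_cre_col[of j x] norm_ann_cre_row[of \<alpha> x]
  by (smt (verit) power2_le_imp_le norm_ge_zero zero_le_power2)+

section \<open>Transport of the defects: the algebraic identities\<close>

text \<open>
  The zeroth-order operators by which \<open>\<nabla>v\<close> and \<open>\<nabla>d\<close> act on \<open>\<mu>\<close>; the conventions are
  \<open>P i k = \<partial>\<^sub>i v\<^sub>k\<close> and \<open>S \<alpha> i = \<partial>\<^sub>i d\<^sub>\<alpha>\<close>.
\<close>

definition shear :: "('n \<Rightarrow> 'n \<Rightarrow> real) \<Rightarrow> ('m::{finite,linorder}, 'n::{finite,linorder}) fock \<Rightarrow> ('m, 'n) fock" where
  "shear P x = (\<Sum>i\<in>UNIV. \<Sum>k\<in>UNIV. P i k *\<^sub>R cre_col i (ann_col k x))"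

definition source :: "('m \<Rightarrow> 'n \<Rightarrow> real) \<Rightarrow> ('m::{finite,linorder}, 'n::{finite,linorder}) fock \<Rightarrow> ('m, 'n) fock" where
  "source S x = (\<Sum>\<alpha>\<in>UNIV. \<Sum>i\<in>UNIV. S \<alpha> i *\<^sub>R cre_row \<alpha> (cre_col i x))"

lemma linear_shear: "linear (shear P)" and linear_source: "linear (source S)"
  unfolding shear_def[abs_def] source_def[abs_def]
  by (auto intro!: linear_compose_sum linear_compose_scale_right linear_fock
      linear_compose[OF linear_fock(1) linear_fock(2), unfolded o_def]
      linear_compose[OF linear_fock(2) linear_fock(4), unfolded o_def])

lemmas op_linear_simps = fock_linear_simps
  linear_shear[THEN linear_add] linear_shear[THEN linear_diff] linear_shear[THEN linear_scale] linear_shear[THEN linear_sum]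
  linear_source[THEN linear_add] linear_source[THEN linear_diff] linear_source[THEN linear_scale] linear_source[THEN linear_sum]

lemma norm_shear_le: "norm (shear P x) \<le> (\<Sum>i\<in>UNIV. \<Sum>k\<in>UNIV. \<bar>P i k\<bar>) * norm x"
  unfolding shear_def sum_distrib_right
  by (intro sum_norm_le) (auto intro!: mult_left_mono order_trans[OF norm_fock_le(2) norm_fock_le(1)])

lemma norm_source_le: "norm (source S x) \<le> (\<Sum>\<alpha>\<in>UNIV. \<Sum>i\<in>UNIV. \<bar>S \<alpha> i\<bar>) * norm x"
  unfolding source_def sum_distrib_right
  by (intro sum_norm_le) (auto intro!: mult_left_mono order_trans[OF norm_fock_le(3) norm_fock_le(2)])

lemma ann_cre_swap:
  "ann_col i (cre_col j x) = (if i = j then x else 0) - cre_col j (ann_col i x)"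
  "ann_row \<alpha> (cre_row \<beta> y) = (if \<alpha> = \<beta> then y else 0) - cre_row \<beta> (ann_row \<alpha> y)"
  using col_anticommutator[of i j x] row_anticommutator[of \<alpha> \<beta> y] by (simp_all add: algebra_simps)

lemma sum_scaleR_delta:
  fixes c :: "'k::finite \<Rightarrow> real" and x :: "'b::real_vector"
  shows "(\<Sum>i\<in>UNIV. c i *\<^sub>R (if j = i then x else 0)) = c j *\<^sub>R x"
proof -
  have "(\<lambda>i. c i *\<^sub>R (if j = i then x else 0)) = (\<lambda>i. if j = i then c i *\<^sub>R x else 0)" by auto
  then have "(\<Sum>i\<in>UNIV. c i *\<^sub>R (if j = i then x else 0)) = (\<Sum>i\<in>UNIV. if j = i then c i *\<^sub>R x else 0)"
    by (rule arg_cong)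
  also have "\<dots> = c j *\<^sub>R x" by (rule sum.delta'[THEN trans]) auto
  finally show ?thesis .
qed

text \<open>
  \<open>shear\<close> is a derivation: commuting a column operator past \<open>c\<^sub>i\<^sup>* c\<^sub>k\<close> leaves one operator.
\<close>

lemma shear_commutators:
  "ann_col j (shear P x) = shear P (ann_col j x) + (\<Sum>k\<in>UNIV. P j k *\<^sub>R ann_col k x)"
  "cre_col j (shear P x) = shear P (cre_col j x) - (\<Sum>k\<in>UNIV. P k j *\<^sub>R cre_col k x)"
  "ann_row \<alpha> (shear P x) = shear P (ann_row \<alpha> x)"
  "cre_row \<alpha> (shear P x) = shear P (cre_row \<alpha> x)"
proof -
  have "ann_col j (cre_col i (ann_col k x)) = (if j = i then ann_col k x else 0) + cre_col i (ann_col k (ann_col j x))"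
    for i k by (simp add: ann_cre_swap ann_col_anticommute[of j k] fock_linear_simps)
  then have "ann_col j (shear P x) = (\<Sum>i\<in>UNIV. \<Sum>k\<in>UNIV. P i k *\<^sub>R (if j = i then ann_col k x else 0))
      + shear P (ann_col j x)"
    by (simp add: shear_def fock_linear_simps scaleR_add_right sum.distrib)
  moreover have "(\<Sum>i\<in>UNIV. \<Sum>k\<in>UNIV. P i k *\<^sub>R (if j = i then ann_col k x else 0)) = (\<Sum>k\<in>UNIV. P j k *\<^sub>R ann_col k x)"
    by (subst sum.swap) (simp add: sum_scaleR_delta)
  ultimately show "ann_col j (shear P x) = shear P (ann_col j x) + (\<Sum>k\<in>UNIV. P j k *\<^sub>R ann_col k x)" by simp
  have "cre_col j (cre_col i (ann_col k x)) = cre_col i (ann_col k (cre_col j x)) - (if j = k then cre_col i x else 0)"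
    for i k by (simp add: ann_cre_swap cre_col_anticommute[of j i] fock_linear_simps)
  then have "cre_col j (shear P x) = shear P (cre_col j x)
      - (\<Sum>i\<in>UNIV. \<Sum>k\<in>UNIV. P i k *\<^sub>R (if j = k then cre_col i x else 0))"
    by (simp add: shear_def fock_linear_simps scaleR_diff_right sum_subtractf)
  then show "cre_col j (shear P x) = shear P (cre_col j x) - (\<Sum>k\<in>UNIV. P k j *\<^sub>R cre_col k x)"
    by (simp add: sum_scaleR_delta)
qed (simp_all add: shear_def fock_linear_simps row_col_commute)

text \<open>
  Rows and columns commute, so moving a single operator past \<open>r\<^sub>\<alpha>\<^sup>* c\<^sub>i\<^sup>*\<close> crosses just one operator of
  its own kind and costs a sign: \<open>source\<close> anticommutes up to the contraction term. This is why
  \<open>source\<close> appears with opposite signs in the equations for \<open>\<mu>\<close> and for the defects.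
\<close>

lemma source_commutators:
  "ann_col j (source S x) = (\<Sum>\<alpha>\<in>UNIV. S \<alpha> j *\<^sub>R cre_row \<alpha> x) - source S (ann_col j x)"
  "cre_col j (source S x) = - source S (cre_col j x)"
  "ann_row \<alpha> (source S x) = (\<Sum>i\<in>UNIV. S \<alpha> i *\<^sub>R cre_col i x) - source S (ann_row \<alpha> x)"
  "cre_row \<alpha> (source S x) = - source S (cre_row \<alpha> x)"
proof -
  have "ann_col j (cre_row \<alpha> (cre_col i x)) = (if j = i then cre_row \<alpha> x else 0) - cre_row \<alpha> (cre_col i (ann_col j x))"
    for i \<alpha> by (simp add: ann_cre_swap row_col_commute(3)[symmetric] fock_linear_simps)
  then have "ann_col j (source S x) = (\<Sum>\<alpha>\<in>UNIV. \<Sum>i\<in>UNIV. S \<alpha> i *\<^sub>R (if j = i then cre_row \<alpha> x else 0))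
      - source S (ann_col j x)"
    by (simp add: source_def fock_linear_simps scaleR_diff_right sum_subtractf)
  then show "ann_col j (source S x) = (\<Sum>\<alpha>\<in>UNIV. S \<alpha> j *\<^sub>R cre_row \<alpha> x) - source S (ann_col j x)"
    by (simp add: sum_scaleR_delta)
  have "ann_row \<alpha> (cre_row \<beta> (cre_col i x)) = (if \<alpha> = \<beta> then cre_col i x else 0) - cre_row \<beta> (cre_col i (ann_row \<alpha> x))"
    for i \<beta> by (simp add: ann_cre_swap row_col_commute fock_linear_simps)
  then have "ann_row \<alpha> (source S x) = (\<Sum>\<beta>\<in>UNIV. \<Sum>i\<in>UNIV. S \<beta> i *\<^sub>R (if \<alpha> = \<beta> then cre_col i x else 0))
      - source S (ann_row \<alpha> x)"
    by (simp add: source_def fock_linear_simps scaleR_diff_right sum_subtractf)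
  moreover have "(\<Sum>\<beta>\<in>UNIV. \<Sum>i\<in>UNIV. S \<beta> i *\<^sub>R (if \<alpha> = \<beta> then cre_col i x else 0)) = (\<Sum>i\<in>UNIV. S \<alpha> i *\<^sub>R cre_col i x)"
    by (subst sum.swap) (simp add: sum_scaleR_delta)
  ultimately show "ann_row \<alpha> (source S x) = (\<Sum>i\<in>UNIV. S \<alpha> i *\<^sub>R cre_col i x) - source S (ann_row \<alpha> x)" by simp
  have "cre_col j (cre_row \<alpha> (cre_col i x)) = - cre_row \<alpha> (cre_col i (cre_col j x))" for i \<alpha>
    by (simp add: cre_col_anticommute[of j i] row_col_commute(4)[symmetric] fock_linear_simps)
  then show "cre_col j (source S x) = - source S (cre_col j x)"
    by (simp add: source_def fock_linear_simps sum_negf)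
  have "cre_row \<alpha> (cre_row \<beta> (cre_col i x)) = - cre_row \<beta> (cre_col i (cre_row \<alpha> x))" for i \<beta>
    by (simp add: cre_row_anticommute[of \<alpha> \<beta>] row_col_commute fock_linear_simps)
  then show "cre_row \<alpha> (source S x) = - source S (cre_row \<alpha> x)"
    by (simp add: source_def fock_linear_simps sum_negf)
qed

text \<open>
  The contraction terms of \<open>c\<^sub>j\<close> with \<open>shear\<close> and \<open>source\<close> are matched by the derivative of the
  coefficients \<open>M \<alpha> j\<close>, which are themselves entries of \<open>\<mu>\<close>. What remains is linear in \<open>E\<close>.
\<close>

lemma minor_defect_transport:
  fixes \<mu> D\<mu> :: "('m::{finite,linorder}, 'n::{finite,linorder}) fock"
  assumes D\<mu>: "D\<mu> = w *\<^sub>R \<mu> - shear P \<mu> - source S \<mu>"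
    and D\<tau>: "D\<tau> = w * \<tau>"
    and DM: "\<And>\<alpha> j. DM \<alpha> j = w * M \<alpha> j - (\<Sum>k\<in>UNIV. P j k * M \<alpha> k) - \<tau> * S \<alpha> j"
    and E: "\<And>j. E j = \<tau> *\<^sub>R ann_col j \<mu> - (\<Sum>\<alpha>\<in>UNIV. M \<alpha> j *\<^sub>R cre_row \<alpha> \<mu>)"
  shows "D\<tau> *\<^sub>R ann_col j \<mu> + \<tau> *\<^sub>R ann_col j D\<mu>
       - (\<Sum>\<alpha>\<in>UNIV. DM \<alpha> j *\<^sub>R cre_row \<alpha> \<mu> + M \<alpha> j *\<^sub>R cre_row \<alpha> D\<mu>)
     = (2 * w) *\<^sub>R E j - shear P (E j) + source S (E j) - (\<Sum>k\<in>UNIV. P j k *\<^sub>R E k)"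
proof -
  have PE: "(\<Sum>k\<in>UNIV. P j k *\<^sub>R E k) = \<tau> *\<^sub>R (\<Sum>k\<in>UNIV. P j k *\<^sub>R ann_col k \<mu>)
      - (\<Sum>\<alpha>\<in>UNIV. (\<Sum>k\<in>UNIV. P j k * M \<alpha> k) *\<^sub>R cre_row \<alpha> \<mu>)"
  proof -
    have "(\<Sum>k\<in>UNIV. P j k *\<^sub>R (\<Sum>\<alpha>\<in>UNIV. M \<alpha> k *\<^sub>R cre_row \<alpha> \<mu>))
        = (\<Sum>\<alpha>\<in>UNIV. (\<Sum>k\<in>UNIV. P j k * M \<alpha> k) *\<^sub>R cre_row \<alpha> \<mu>)"
      by (simp add: scaleR_sum_right scaleR_sum_left) (rule sum.swap)
    then show ?thesis
      by (simp add: E scaleR_diff_right sum_subtractf scaleR_sum_right mult.commute)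
  qed
  have LE: "shear P (E j) = \<tau> *\<^sub>R shear P (ann_col j \<mu>) - (\<Sum>\<alpha>\<in>UNIV. M \<alpha> j *\<^sub>R shear P (cre_row \<alpha> \<mu>))"
    "source S (E j) = \<tau> *\<^sub>R source S (ann_col j \<mu>) - (\<Sum>\<alpha>\<in>UNIV. M \<alpha> j *\<^sub>R source S (cre_row \<alpha> \<mu>))"
    by (simp_all add: E op_linear_simps)
  have DM_sum: "(\<Sum>\<alpha>\<in>UNIV. DM \<alpha> j *\<^sub>R cre_row \<alpha> \<mu> + M \<alpha> j *\<^sub>R cre_row \<alpha> D\<mu>)
    = (2 * w) *\<^sub>R (\<Sum>\<alpha>\<in>UNIV. M \<alpha> j *\<^sub>R cre_row \<alpha> \<mu>)
      - (\<Sum>\<alpha>\<in>UNIV. (\<Sum>k\<in>UNIV. P j k * M \<alpha> k) *\<^sub>R cre_row \<alpha> \<mu>)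
      - \<tau> *\<^sub>R (\<Sum>\<alpha>\<in>UNIV. S \<alpha> j *\<^sub>R cre_row \<alpha> \<mu>)
      - (\<Sum>\<alpha>\<in>UNIV. M \<alpha> j *\<^sub>R shear P (cre_row \<alpha> \<mu>))
      + (\<Sum>\<alpha>\<in>UNIV. M \<alpha> j *\<^sub>R source S (cre_row \<alpha> \<mu>))"
    unfolding scaleR_sum_right sum.distrib[symmetric] sum_subtractf[symmetric]
    by (rule sum.cong)
       (simp_all add: DM D\<mu> fock_linear_simps shear_commutators source_commutators algebra_simps
         scaleR_2[symmetric])
  have "\<tau> *\<^sub>R ann_col j D\<mu> = (w * \<tau>) *\<^sub>R ann_col j \<mu> - \<tau> *\<^sub>R shear P (ann_col j \<mu>)
      - \<tau> *\<^sub>R (\<Sum>k\<in>UNIV. P j k *\<^sub>R ann_col k \<mu>)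
      - \<tau> *\<^sub>R (\<Sum>\<alpha>\<in>UNIV. S \<alpha> j *\<^sub>R cre_row \<alpha> \<mu>) + \<tau> *\<^sub>R source S (ann_col j \<mu>)"
    by (simp add: D\<mu> fock_linear_simps shear_commutators source_commutators algebra_simps)
  note tau_D\<mu> = this
  show ?thesis
    unfolding PE LE DM_sum tau_D\<mu> D\<tau>
    unfolding E[of j] scaleR_diff_right mult_2 by (simp only: algebra_simps scaleR_scaleR)
qed

lemma inner_cre_col:
  "cre_col j x \<bullet> cre_col i y = (if i = j then x \<bullet> y else 0) - cre_col j (ann_col i x) \<bullet> y"
  "cre_col j x \<bullet> ann_row \<alpha> y = cre_row \<alpha> (cre_col j x) \<bullet> y"
proof -
  have "cre_col j x \<bullet> cre_col i y = ann_col i (cre_col j x) \<bullet> y"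
    by (metis cre_col_adjoint inner_commute)
  then show "cre_col j x \<bullet> cre_col i y = (if i = j then x \<bullet> y else 0) - cre_col j (ann_col i x) \<bullet> y"
    by (simp add: ann_cre_swap inner_diff_left)
  show "cre_col j x \<bullet> ann_row \<alpha> y = cre_row \<alpha> (cre_col j x) \<bullet> y"
    by (simp add: cre_row_adjoint)
qed

text \<open>
  Expanding \<open>z' j\<close>, the derivative of \<open>z\<close> in the direction \<open>j\<close>, produces four kinds of terms, namely
  those with \<open>\<partial>v\<close>, \<open>\<partial>d\<close>, and \<open>v\<close> or \<open>d\<close> times \<open>\<partial>\<mu>\<close>. The anticommutation relation of the columns
  identifies them with the contributions of \<open>D \<mu>\<close>, \<open>D v\<close> and \<open>D d\<close>.
\<close>

lemma energy_defect_transport: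
  fixes \<mu> D\<mu> :: "('m::{finite,linorder}, 'n::{finite,linorder}) fock"
  assumes D\<mu>: "D\<mu> = (\<Sum>i\<in>UNIV. P i i) *\<^sub>R \<mu> - shear P \<mu> - source S \<mu>"
    and Dv: "\<And>i. Dv i = \<mu> \<bullet> \<mu>' i - (\<Sum>j\<in>UNIV. cre_col j (ann_col i \<mu>) \<bullet> \<mu>' j)"
    and Dd: "\<And>\<alpha>. Dd \<alpha> = - (\<Sum>j\<in>UNIV. cre_row \<alpha> (cre_col j \<mu>) \<bullet> \<mu>' j)"
    and z': "\<And>j. z' j = (\<Sum>i\<in>UNIV. P j i *\<^sub>R cre_col i \<mu> + v i *\<^sub>R cre_col i (\<mu>' j))
        - (\<Sum>\<alpha>\<in>UNIV. S \<alpha> j *\<^sub>R ann_row \<alpha> \<mu> + d \<alpha> *\<^sub>R ann_row \<alpha> (\<mu>' j))"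
  shows "(\<Sum>\<alpha>\<in>UNIV. d \<alpha> * Dd \<alpha>) + (\<Sum>i\<in>UNIV. v i * Dv i) + \<mu> \<bullet> D\<mu> = (\<Sum>j\<in>UNIV. cre_col j \<mu> \<bullet> z' j)"
proof -
  have P: "(\<Sum>j\<in>UNIV. \<Sum>i\<in>UNIV. P j i * (cre_col j \<mu> \<bullet> cre_col i \<mu>))
      = (\<Sum>i\<in>UNIV. P i i) * (\<mu> \<bullet> \<mu>) - \<mu> \<bullet> shear P \<mu>"
    by (simp add: inner_cre_col(1) right_diff_distrib sum_subtractf shear_def inner_sum_right
        if_distrib[of "(*) _"] sum_distrib_right inner_commute cong: if_cong)
  have v: "(\<Sum>j\<in>UNIV. \<Sum>i\<in>UNIV. v i * (cre_col j \<mu> \<bullet> cre_col i (\<mu>' j))) = (\<Sum>i\<in>UNIV. v i * Dv i)"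
    by (subst sum.swap)
       (simp add: Dv inner_cre_col(1) right_diff_distrib sum_subtractf sum_distrib_left
         if_distrib[of "(*) _"] cong: if_cong)
  have S: "(\<Sum>j\<in>UNIV. \<Sum>\<alpha>\<in>UNIV. S \<alpha> j * (cre_col j \<mu> \<bullet> ann_row \<alpha> \<mu>)) = \<mu> \<bullet> source S \<mu>"
  proof -
    have "cre_col j \<mu> \<bullet> ann_row \<alpha> \<mu> = \<mu> \<bullet> cre_row \<alpha> (cre_col j \<mu>)" for j \<alpha>
      by (metis inner_cre_col(2) inner_commute)
    then show ?thesis by (subst sum.swap) (simp add: source_def inner_sum_right)
  qed
  have d: "(\<Sum>j\<in>UNIV. \<Sum>\<alpha>\<in>UNIV. d \<alpha> * (cre_col j \<mu> \<bullet> ann_row \<alpha> (\<mu>' j))) = - (\<Sum>\<alpha>\<in>UNIV. d \<alpha> * Dd \<alpha>)"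
    by (subst sum.swap) (simp add: inner_cre_col(2) Dd sum_distrib_left sum_negf)
  have "(\<Sum>j\<in>UNIV. cre_col j \<mu> \<bullet> z' j) =
      (\<Sum>j\<in>UNIV. \<Sum>i\<in>UNIV. P j i * (cre_col j \<mu> \<bullet> cre_col i \<mu>))
    + (\<Sum>j\<in>UNIV. \<Sum>i\<in>UNIV. v i * (cre_col j \<mu> \<bullet> cre_col i (\<mu>' j)))
    - (\<Sum>j\<in>UNIV. \<Sum>\<alpha>\<in>UNIV. S \<alpha> j * (cre_col j \<mu> \<bullet> ann_row \<alpha> \<mu>))
    - (\<Sum>j\<in>UNIV. \<Sum>\<alpha>\<in>UNIV. d \<alpha> * (cre_col j \<mu> \<bullet> ann_row \<alpha> (\<mu>' j)))"
    by (simp add: z' inner_diff_right inner_sum_right inner_add_right sum.distrib sum_subtractf)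
  then show ?thesis by (simp add: P v S d D\<mu> inner_diff_right)
qed

text \<open>
  The coefficients of \<open>cre_col i \<mu>\<close> on the right are \<open>\<partial>\<^sub>i \<lambda>\<close>. The commutators of \<open>shear\<close> and \<open>source\<close>
  produce its parts with \<open>v\<close> and \<open>d\<close>, and \<open>D v\<close> produces \<open>\<langle>\<mu>, \<partial>\<^sub>i \<mu>\<rangle>\<close>. The other terms of \<open>D v\<close> and
  \<open>D d\<close> cancel by the expansions \<open>c\<^sub>i \<mu> = F\<^bsub>\<alpha>i\<^esub> r\<^sub>\<alpha>\<^sup>* \<mu>\<close> and \<open>r\<^sub>\<alpha> \<mu> = F\<^bsub>\<alpha>i\<^esub> c\<^sub>i\<^sup>* \<mu>\<close>.
\<close>

lemma momentum_defect_transport: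
  fixes \<mu> D\<mu> :: "('m::{finite,linorder}, 'n::{finite,linorder}) fock"
  assumes D\<mu>: "D\<mu> = w *\<^sub>R \<mu> - shear P \<mu> - source S \<mu>"
    and Dv: "\<And>i. Dv i = \<mu> \<bullet> \<mu>' i - (\<Sum>j\<in>UNIV. cre_col j (ann_col i \<mu>) \<bullet> \<mu>' j)"
    and Dd: "\<And>\<alpha>. Dd \<alpha> = - (\<Sum>j\<in>UNIV. cre_row \<alpha> (cre_col j \<mu>) \<bullet> \<mu>' j)"
    and z: "z = (\<Sum>i\<in>UNIV. v i *\<^sub>R cre_col i \<mu>) - (\<Sum>\<alpha>\<in>UNIV. d \<alpha> *\<^sub>R ann_row \<alpha> \<mu>)"
    and col: "\<And>i. ann_col i \<mu> = (\<Sum>\<alpha>\<in>UNIV. F \<alpha> i *\<^sub>R cre_row \<alpha> \<mu>)"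
    and row: "\<And>\<alpha>. ann_row \<alpha> \<mu> = (\<Sum>i\<in>UNIV. F \<alpha> i *\<^sub>R cre_col i \<mu>)"
  shows "(\<Sum>i\<in>UNIV. Dv i *\<^sub>R cre_col i \<mu> + v i *\<^sub>R cre_col i D\<mu>)
      - (\<Sum>\<alpha>\<in>UNIV. Dd \<alpha> *\<^sub>R ann_row \<alpha> \<mu> + d \<alpha> *\<^sub>R ann_row \<alpha> D\<mu>)
    = (\<Sum>i\<in>UNIV. ((\<Sum>\<alpha>\<in>UNIV. d \<alpha> * S \<alpha> i) + (\<Sum>k\<in>UNIV. v k * P i k) + \<mu> \<bullet> \<mu>' i) *\<^sub>R cre_col i \<mu>)
      - shear P z + source S z + w *\<^sub>R z"
proof -
  have cancel: "(\<Sum>i\<in>UNIV. (\<Sum>j\<in>UNIV. cre_col j (ann_col i \<mu>) \<bullet> \<mu>' j) *\<^sub>R cre_col i \<mu>)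
      = (\<Sum>\<alpha>\<in>UNIV. (\<Sum>j\<in>UNIV. cre_row \<alpha> (cre_col j \<mu>) \<bullet> \<mu>' j) *\<^sub>R ann_row \<alpha> \<mu>)"
  proof -
    have "(\<Sum>j\<in>UNIV. cre_col j (ann_col i \<mu>) \<bullet> \<mu>' j)
        = (\<Sum>\<alpha>\<in>UNIV. F \<alpha> i * (\<Sum>j\<in>UNIV. cre_row \<alpha> (cre_col j \<mu>) \<bullet> \<mu>' j))" for i
      by (simp add: col fock_linear_simps inner_sum_left sum_distrib_left row_col_commute(4))
         (rule sum.swap)
    then show ?thesis
      by (simp add: row scaleR_sum_left scaleR_sum_right mult.commute) (rule sum.swap)
  qed
  have vk: "(\<Sum>i\<in>UNIV. v i *\<^sub>R (\<Sum>k\<in>UNIV. P k i *\<^sub>R cre_col k \<mu>))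
      = (\<Sum>i\<in>UNIV. (\<Sum>k\<in>UNIV. v k * P i k) *\<^sub>R cre_col i \<mu>)"
    by (simp add: scaleR_sum_left scaleR_sum_right) (rule sum.swap)
  have dS: "(\<Sum>\<alpha>\<in>UNIV. d \<alpha> *\<^sub>R (\<Sum>i\<in>UNIV. S \<alpha> i *\<^sub>R cre_col i \<mu>))
      = (\<Sum>i\<in>UNIV. (\<Sum>\<alpha>\<in>UNIV. d \<alpha> * S \<alpha> i) *\<^sub>R cre_col i \<mu>)"
    by (simp add: scaleR_sum_left scaleR_sum_right) (rule sum.swap)
  have v_D\<mu>: "(\<Sum>i\<in>UNIV. v i *\<^sub>R cre_col i D\<mu>) =
      w *\<^sub>R (\<Sum>i\<in>UNIV. v i *\<^sub>R cre_col i \<mu>) - shear P (\<Sum>i\<in>UNIV. v i *\<^sub>R cre_col i \<mu>)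
      + (\<Sum>i\<in>UNIV. (\<Sum>k\<in>UNIV. v k * P i k) *\<^sub>R cre_col i \<mu>) + source S (\<Sum>i\<in>UNIV. v i *\<^sub>R cre_col i \<mu>)"
    by (simp add: D\<mu> op_linear_simps shear_commutators source_commutators vk[symmetric]
        scaleR_add_right scaleR_diff_right sum.distrib sum_subtractf
        scaleR_sum_right[of w] mult.commute[of w])
  have d_D\<mu>: "(\<Sum>\<alpha>\<in>UNIV. d \<alpha> *\<^sub>R ann_row \<alpha> D\<mu>) =
      w *\<^sub>R (\<Sum>\<alpha>\<in>UNIV. d \<alpha> *\<^sub>R ann_row \<alpha> \<mu>) - shear P (\<Sum>\<alpha>\<in>UNIV. d \<alpha> *\<^sub>R ann_row \<alpha> \<mu>)
      - (\<Sum>i\<in>UNIV. (\<Sum>\<alpha>\<in>UNIV. d \<alpha> * S \<alpha> i) *\<^sub>R cre_col i \<mu>) + source S (\<Sum>\<alpha>\<in>UNIV. d \<alpha> *\<^sub>R ann_row \<alpha> \<mu>)"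
    by (simp add: D\<mu> op_linear_simps shear_commutators source_commutators dS[symmetric]
        scaleR_add_right scaleR_diff_right sum.distrib sum_subtractf
        scaleR_sum_right[of w] mult.commute[of w])
  have "(\<Sum>i\<in>UNIV. Dv i *\<^sub>R cre_col i \<mu>) - (\<Sum>\<alpha>\<in>UNIV. Dd \<alpha> *\<^sub>R ann_row \<alpha> \<mu>)
      = (\<Sum>i\<in>UNIV. (\<mu> \<bullet> \<mu>' i) *\<^sub>R cre_col i \<mu>)"
    using cancel by (simp add: Dv Dd scaleR_diff_left sum_subtractf sum_negf)
  then have Dv_Dd: "(\<Sum>i\<in>UNIV. Dv i *\<^sub>R cre_col i \<mu>)
      = (\<Sum>i\<in>UNIV. (\<mu> \<bullet> \<mu>' i) *\<^sub>R cre_col i \<mu>) + (\<Sum>\<alpha>\<in>UNIV. Dd \<alpha> *\<^sub>R ann_row \<alpha> \<mu>)"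
    by (simp only: diff_eq_eq)
  show ?thesis
    unfolding sum.distrib scaleR_add_left v_D\<mu> d_D\<mu> Dv_Dd z
      linear_shear[THEN linear_diff] linear_source[THEN linear_diff] scaleR_diff_right
    by (simp only: algebra_simps)
qed

section \<open>Minors as a Fock vector\<close>

text \<open>
  Minors along lists admit repeated columns, which are needed for the expansion along a foreign
  column.
\<close>

definition list_minor :: "('a \<Rightarrow> 'b \<Rightarrow> real) \<Rightarrow> 'a list \<Rightarrow> 'b list \<Rightarrow> real" where
  "list_minor F as bs = Determinant.det (Matrix.mat (length as) (length bs) (\<lambda>(k, l). F (as ! k) (bs ! l)))"

lemma minor_eq_list_minor: "minor F A I = list_minor F (sorted_list_of_set A) (sorted_list_of_set I)"
  by (simp add: minor_def list_minor_def)

lemma nth_delete: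
  "k < length xs \<Longrightarrow> i < length xs - 1 \<Longrightarrow>
    (take k xs @ drop (Suc k) xs) ! i = xs ! (if i < k then i else Suc i)"
  by (auto simp: nth_append min_def)

lemma list_minor_expansion:
  assumes len: "length as = length bs" and l: "l < length bs"
  shows "list_minor F as bs = (\<Sum>k<length as. F (as ! k) (bs ! l) * ((-1) ^ (k + l)
     * list_minor F (take k as @ drop (Suc k) as) (take l bs @ drop (Suc l) bs)))"
proof -
  let ?X = "Matrix.mat (length as) (length bs) (\<lambda>(k, l). F (as ! k) (bs ! l))"
  have "mat_delete ?X k l = Matrix.mat (length (take k as @ drop (Suc k) as)) (length (take l bs @ drop (Suc l) bs))
     (\<lambda>(i, j). F ((take k as @ drop (Suc k) as) ! i) ((take l bs @ drop (Suc l) bs) ! j))"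
    if "k < length as" for k
    using that l len unfolding mat_delete_def
    by (intro eq_matI) (auto simp: nth_delete simp del: nth_append)
  then show ?thesis
    unfolding list_minor_def using len l
    by (subst laplace_expansion_column[of ?X "length bs" l]) (auto simp: cofactor_def intro!: sum.cong)
qed

context
  fixes A :: "'k::{finite,linorder} set" and k :: nat
  assumes k: "k < card A"
begin

lemma card_less_nth_sorted_list: "card {b \<in> A. b < sorted_list_of_set A ! k} = k"
proof -
  let ?xs = "sorted_list_of_set A"
  have inc: "?xs ! i < ?xs ! j \<longleftrightarrow> i < j" if "i < card A" "j < card A" for i j
    using that sorted_wrt_nth_less[OF strict_sorted_list_of_set[of A], of i j]
      sorted_wrt_nth_less[OF strict_sorted_list_of_set[of A], of j i]
    by (cases i j rule: linorder_cases) auto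
  have "{b \<in> A. b < ?xs ! k} = (\<lambda>i. ?xs ! i) ` {..<k}"
  proof (intro equalityI subsetI)
    fix b assume "b \<in> {b \<in> A. b < ?xs ! k}"
    then obtain i where "i < card A" "b = ?xs ! i" "b < ?xs ! k"
      by (metis (mono_tags, lifting) finite in_set_conv_nth length_sorted_list_of_set mem_Collect_eq set_sorted_list_of_set)
    then show "b \<in> (\<lambda>i. ?xs ! i) ` {..<k}" using inc k by auto
  next
    fix b assume "b \<in> (\<lambda>i. ?xs ! i) ` {..<k}"
    then obtain i where i: "i < k" "b = ?xs ! i" by auto
    then have "b \<in> set ?xs" using k by (metis length_sorted_list_of_set nth_mem order_less_trans)
    with i inc k show "b \<in> {b \<in> A. b < ?xs ! k}" by auto
  qed
  moreover have "inj_on (\<lambda>i. ?xs ! i) {..<k}"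
    using k by (intro inj_on_nth) auto
  ultimately show ?thesis by (simp add: card_image)
qed

lemma pos_sign_nth_sorted_list: "pos_sign A (sorted_list_of_set A ! k) = (-1) ^ k"
  by (simp add: pos_sign_def card_less_nth_sorted_list)

lemma sorted_list_of_set_remove_nth:
  "sorted_list_of_set (A - {sorted_list_of_set A ! k})
    = take k (sorted_list_of_set A) @ drop (Suc k) (sorted_list_of_set A)"
proof -
  let ?xs = "sorted_list_of_set A"
  have eq: "?xs = take k ?xs @ ?xs ! k # drop (Suc k) ?xs"
    using k by (simp add: id_take_nth_drop)
  have "distinct (take k ?xs @ ?xs ! k # drop (Suc k) ?xs)"
    unfolding eq[symmetric] by simp
  then have "remove1 (?xs ! k) (take k ?xs @ ?xs ! k # drop (Suc k) ?xs) = take k ?xs @ drop (Suc k) ?xs"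
    by (simp add: remove1_append)
  then show ?thesis
    unfolding eq[symmetric] by (simp add: sorted_list_of_set.sorted_key_list_of_set_remove)
qed

end

lemma sum_nth_sorted_list:
  fixes A :: "'k::{finite,linorder} set"
  shows "(\<Sum>k<card A. f (sorted_list_of_set A ! k)) = (\<Sum>\<alpha>\<in>A. f \<alpha>)"
  by (rule sum.reindex_bij_betw, rule bij_betw_nth) auto

lemma minor_column_expansion:
  fixes A :: "'m::{finite,linorder} set" and I :: "'n::{finite,linorder} set"
  assumes card: "card A = card I" and j: "j \<in> I"
  shows "minor F A I = pos_sign I j * (\<Sum>\<alpha>\<in>A. F \<alpha> j * (pos_sign A \<alpha> * minor F (A - {\<alpha>}) (I - {j})))"
proof -
  obtain l where l: "l < card I" "sorted_list_of_set I ! l = j"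
    using j by (metis finite in_set_conv_nth length_sorted_list_of_set set_sorted_list_of_set)
  have "minor F A I = (\<Sum>k<card A. F (sorted_list_of_set A ! k) j * ((-1) ^ (k + l) *
      minor F (A - {sorted_list_of_set A ! k}) (I - {j})))"
    unfolding minor_eq_list_minor
    using list_minor_expansion[of "sorted_list_of_set A" "sorted_list_of_set I" l F] card l
      sorted_list_of_set_remove_nth[OF l(1)]
    by (simp add: sorted_list_of_set_remove_nth)
  also have "\<dots> = (\<Sum>k<card A. F (sorted_list_of_set A ! k) j *
      (pos_sign A (sorted_list_of_set A ! k) * pos_sign I j *
      minor F (A - {sorted_list_of_set A ! k}) (I - {j})))"
    using pos_sign_nth_sorted_list[OF l(1)] l(2)
    by (intro sum.cong) (auto simp: pos_sign_nth_sorted_list power_add)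
  also have "\<dots> = (\<Sum>\<alpha>\<in>A. F \<alpha> j * (pos_sign A \<alpha> * pos_sign I j * minor F (A - {\<alpha>}) (I - {j})))"
    by (rule sum_nth_sorted_list)
  finally show ?thesis by (simp add: sum_distrib_left mult_ac)
qed

text \<open>
  The sum expands, along its first column, the determinant in which column \<open>j\<close> is put in front of
  the columns \<open>I\<close>; since \<open>j\<close> already lies in \<open>I\<close>, two columns agree.
\<close>

lemma minor_alien_column_expansion:
  fixes A :: "'m::{finite,linorder} set" and I :: "'n::{finite,linorder} set"
  assumes card: "card A = Suc (card I)" and j: "j \<in> I"
  shows "(\<Sum>\<alpha>\<in>A. F \<alpha> j * (pos_sign A \<alpha> * minor F (A - {\<alpha>}) I)) = 0"
proof -
  let ?as = "sorted_list_of_set A" and ?bs = "j # sorted_list_of_set I"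
  obtain l where l: "l < card I" "sorted_list_of_set I ! l = j"
    using j by (metis finite in_set_conv_nth length_sorted_list_of_set set_sorted_list_of_set)
  have "(\<Sum>\<alpha>\<in>A. F \<alpha> j * (pos_sign A \<alpha> * minor F (A - {\<alpha>}) I))
      = (\<Sum>k<card A. F (?as ! k) j * (pos_sign A (?as ! k) * minor F (A - {?as ! k}) I))"
    by (rule sum_nth_sorted_list[symmetric])
  also have "\<dots> = list_minor F ?as ?bs"
    by (subst list_minor_expansion[of ?as ?bs 0])
      (auto simp: card pos_sign_nth_sorted_list minor_eq_list_minor sorted_list_of_set_remove_nth intro!: sum.cong)
  also have "\<dots> = 0"
    unfolding list_minor_def
    by (rule det_identical_columns[of _ "card A" 0 "Suc l"]) (use card l in \<open>auto intro!: eq_vecI\<close>)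
  finally show ?thesis .
qed

lemma minor_transpose:
  fixes A :: "'m::{finite,linorder} set" and I :: "'n::{finite,linorder} set"
  assumes "card A = card I"
  shows "minor F A I = minor (\<lambda>i \<alpha>. F \<alpha> i) I A"
proof -
  let ?X = "Matrix.mat (card A) (card I) (\<lambda>(k, l). F (sorted_list_of_set A ! k) (sorted_list_of_set I ! l))"
  have "transpose_mat ?X = Matrix.mat (card I) (card A)
      (\<lambda>(k, l). F (sorted_list_of_set A ! l) (sorted_list_of_set I ! k))"
    by (rule eq_matI) auto
  then show ?thesis using det_transpose[of ?X "card A"] assms by (simp add: minor_def)
qed

definition minors :: "('m::{finite,linorder} \<Rightarrow> 'n::{finite,linorder} \<Rightarrow> real) \<Rightarrow> ('m, 'n) fock" where
  "minors F = (\<chi> p. case p of (A, I) \<Rightarrow> if card A = card I then minor F A I else 0)"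

lemma minors_nth: "minors F $ (A, I) = (if card A = card I then minor F A I else 0)"
  by (simp add: minors_def)

lemma sum_cre_row_nth:
  "(\<Sum>\<alpha>\<in>UNIV. c \<alpha> *\<^sub>R cre_row \<alpha> x) $ (A, I) = (\<Sum>\<alpha>\<in>A. c \<alpha> * (pos_sign A \<alpha> * x $ (A - {\<alpha>}, I)))"
  by (simp add: fock_nth if_distrib[of "(*) _"] sum.If_cases cong: if_cong)

lemma sum_cre_col_nth:
  "(\<Sum>i\<in>UNIV. c i *\<^sub>R cre_col i x) $ (A, I) = (\<Sum>i\<in>I. c i * (pos_sign I i * x $ (A, I - {i})))"
  by (simp add: fock_nth if_distrib[of "(*) _"] sum.If_cases cong: if_cong)

text \<open>
  Laplace expansion as one vector identity: the entries with \<open>j \<notin> I\<close> are the expansions along column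
  \<open>j\<close>, and those with \<open>j \<in> I\<close> say that expansions along a foreign column vanish.
\<close>

lemma ann_col_minors: "ann_col j (minors F) = (\<Sum>\<alpha>\<in>UNIV. F \<alpha> j *\<^sub>R cre_row \<alpha> (minors F))"
  unfolding fock_eq_iff sum_cre_row_nth
proof (intro allI)
  fix A :: "'a set" and I :: "'b set"
  show "ann_col j (minors F) $ (A, I) = (\<Sum>\<alpha>\<in>A. F \<alpha> j * (pos_sign A \<alpha> * minors F $ (A - {\<alpha>}, I)))"
  proof (cases "card A = Suc (card I)")
    case True
    then have "(\<Sum>\<alpha>\<in>A. F \<alpha> j * (pos_sign A \<alpha> * minors F $ (A - {\<alpha>}, I)))
        = (\<Sum>\<alpha>\<in>A. F \<alpha> j * (pos_sign A \<alpha> * minor F (A - {\<alpha>}) I))"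
      by (intro sum.cong) (auto simp: minors_nth)
    with True minor_alien_column_expansion[of A I j F] minor_column_expansion[of A "insert j I" j F]
    show ?thesis by (auto simp: fock_nth minors_nth pos_sign_cancel)
  next
    case False
    then have "(\<Sum>\<alpha>\<in>A. F \<alpha> j * (pos_sign A \<alpha> * minors F $ (A - {\<alpha>}, I))) = 0"
      by (intro sum.neutral ballI) (auto simp: minors_nth dest!: card.remove[rotated])
    with False show ?thesis by (auto simp: fock_nth minors_nth)
  qed
qed

lemma ann_row_minors: "ann_row \<alpha> (minors F) = (\<Sum>i\<in>UNIV. F \<alpha> i *\<^sub>R cre_col i (minors F))"
  unfolding fock_eq_iff sum_cre_col_nth
proof (intro allI)
  fix A :: "'a set" and I :: "'b set"
  have transpose: "minors F $ (B, J) = minors (\<lambda>i \<beta>. F \<beta> i) $ (J, B)" for B J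
    by (auto simp: minors_nth minor_transpose[of B J F])
  have "ann_col \<alpha> (minors (\<lambda>i \<beta>. F \<beta> i)) $ (I, A)
      = (\<Sum>i\<in>I. F \<alpha> i * (pos_sign I i * minors (\<lambda>i \<beta>. F \<beta> i) $ (I - {i}, A)))"
    by (simp only: ann_col_minors sum_cre_row_nth)
  then show "ann_row \<alpha> (minors F) $ (A, I) = (\<Sum>i\<in>I. F \<alpha> i * (pos_sign I i * minors F $ (A, I - {i})))"
    unfolding fock_nth transpose .
qed

text \<open>
  Conversely, the expansions determine every balanced entry from the one at \<open>(\<emptyset>, \<emptyset>)\<close>, by induction
  on the size of the index sets.
\<close>

lemma minors_unique:
  assumes x: "\<And>j. ann_col j x = (\<Sum>\<alpha>\<in>UNIV. F \<alpha> j *\<^sub>R cre_row \<alpha> x)"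
    and card: "card A = card I"
  shows "x $ (A, I) = x $ ({}, {}) * minor F A I"
  using card
proof (induction "card I" arbitrary: A I)
  case 0
  then have "A = {}" "I = {}" by auto
  then show ?case by (simp add: minor_def)
next
  case (Suc c)
  then obtain j where j: "j \<in> I" by fastforce
  have "x $ (A, I) = pos_sign I j * ann_col j x $ (A, I - {j})"
    using j by (simp add: fock_nth insert_absorb pos_sign_cancel)
  also have "\<dots> = pos_sign I j * (\<Sum>\<alpha>\<in>A. F \<alpha> j * (pos_sign A \<alpha> * x $ (A - {\<alpha>}, I - {j})))"
    by (simp only: x sum_cre_row_nth)
  also have "\<dots> = pos_sign I j * (\<Sum>\<alpha>\<in>A. F \<alpha> j * (pos_sign A \<alpha> * (x $ ({}, {}) * minor F (A - {\<alpha>}) (I - {j}))))"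
    using Suc j by (intro arg_cong2[of _ _ _ _ "(*)"] sum.cong refl) (metis Suc.hyps card_Diff_singleton diff_Suc_1)
  also have "\<dots> = x $ ({}, {}) * minor F A I"
    using minor_column_expansion[of A I j F] Suc j by (simp add: sum_distrib_left mult_ac)
  finally show ?case .
qed

section \<open>Continuously differentiable functions on a slab\<close>

text \<open>
  Vector-valued and relative to \<open>S\<close>, so that derivatives at the faces of a slab are one-sided.
  Continuity of the derivative is asked in each fixed direction, which is what passes through
  bilinear operations without an operator norm.
\<close>

definition C1_on :: "'a::real_normed_vector set \<Rightarrow> ('a \<Rightarrow> 'b::real_normed_vector) \<Rightarrow> bool" where
  "C1_on S f \<longleftrightarrow> (\<exists>f'. (\<forall>p\<in>S. (f has_derivative f' p) (at p within S)) \<and>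
     (\<forall>h. continuous_on S (\<lambda>p. f' p h)))"


lemma C1_on_const: "C1_on S (\<lambda>p. c)"
  unfolding C1_on_def by (rule exI[of _ "\<lambda>p h. 0"]) auto

lemma C1_on_add:
  assumes "C1_on S f" "C1_on S g" shows "C1_on S (\<lambda>p. f p + g p)"
proof -
  from assms obtain f' g' where
    "\<forall>p\<in>S. (f has_derivative f' p) (at p within S)" "\<forall>h. continuous_on S (\<lambda>p. f' p h)"
    "\<forall>p\<in>S. (g has_derivative g' p) (at p within S)" "\<forall>h. continuous_on S (\<lambda>p. g' p h)"
    unfolding C1_on_def by blast
  then show ?thesis
    unfolding C1_on_def
    by (intro exI[of _ "\<lambda>p h. f' p h + g' p h"]) (auto intro!: has_derivative_add continuous_on_add)
qed

lemma (in bounded_linear) C1_on: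
  assumes "C1_on S g" shows "C1_on S (\<lambda>p. f (g p))"
proof -
  from assms obtain g' where
    "\<forall>p\<in>S. (g has_derivative g' p) (at p within S)" "\<forall>h. continuous_on S (\<lambda>p. g' p h)"
    unfolding C1_on_def by blast
  then show ?thesis
    unfolding C1_on_def
    by (intro exI[of _ "\<lambda>p h. f (g' p h)"]) (auto intro!: has_derivative continuous_on)
qed

lemma (in bounded_bilinear) C1_on:
  assumes "C1_on S f" "C1_on S g" shows "C1_on S (\<lambda>p. prod (f p) (g p))"
proof -
  from assms obtain f' g' where
    f': "\<forall>p\<in>S. (f has_derivative f' p) (at p within S)" "\<forall>h. continuous_on S (\<lambda>p. f' p h)" and
    g': "\<forall>p\<in>S. (g has_derivative g' p) (at p within S)" "\<forall>h. continuous_on S (\<lambda>p. g' p h)"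
    unfolding C1_on_def by blast
  moreover have "continuous_on S f" "continuous_on S g"
    using f' g' has_derivative_continuous_on by blast+
  ultimately show ?thesis
    unfolding C1_on_def
    by (intro exI[of _ "\<lambda>p h. prod (f p) (g' p h) + prod (f' p h) (g p)"])
       (auto intro!: FDERIV continuous_on continuous_on_add)
qed

lemmas C1_on_mult = bounded_bilinear.C1_on[OF bounded_bilinear_mult]
lemmas C1_on_scaleR = bounded_bilinear.C1_on[OF bounded_bilinear_scaleR]
lemmas C1_on_inner = bounded_bilinear.C1_on[OF bounded_bilinear_inner]
lemmas C1_on_minus = bounded_linear.C1_on[OF bounded_linear_minus[OF bounded_linear_ident]]
lemmas C1_on_fock = bounded_linear_fock[THEN bounded_linear.C1_on]

lemma C1_on_diff: "C1_on S f \<Longrightarrow> C1_on S g \<Longrightarrow> C1_on S (\<lambda>p. f p - g p)"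
  using C1_on_add[of S f "\<lambda>p. - g p"] C1_on_minus[of S g] by simp

lemma C1_on_sum: "(\<And>i. i \<in> A \<Longrightarrow> C1_on S (f i)) \<Longrightarrow> C1_on S (\<lambda>p. \<Sum>i\<in>A. f i p)"
  by (induction A rule: infinite_finite_induct) (auto intro!: C1_on_const C1_on_add)

lemmas C1_on_intros = C1_on_const C1_on_add C1_on_diff C1_on_sum C1_on_mult C1_on_scaleR C1_on_inner C1_on_fock

lemma C1_on_has_derivative:
  "C1_on S f \<Longrightarrow> p \<in> S \<Longrightarrow> (f has_derivative frechet_derivative f (at p within S)) (at p within S)"
  unfolding C1_on_def frechet_derivative_works[symmetric] differentiable_def by blast

lemma smooth_on_imp_C1_on:
  fixes f :: "'a::euclidean_space \<Rightarrow> real"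
  assumes "smooth_on S f" shows "C1_on S f"
proof -
  have "Ck_on (Suc 0) S f" using assms unfolding smooth_on_def by blast
  then have diff: "f differentiable_on S" and cont: "\<And>b. b \<in> Basis \<Longrightarrow> continuous_on S (dir_deriv S b f)"
    by auto
  let ?f' = "\<lambda>p. frechet_derivative f (at p within S)"
  have f': "(f has_derivative ?f' p) (at p within S)" if "p \<in> S" for p
    using diff that unfolding differentiable_on_def frechet_derivative_works by blast
  have "?f' p h = (\<Sum>b\<in>Basis. (h \<bullet> b) * dir_deriv S b f p)" if "p \<in> S" for p h
    using Linear_Algebra.linear_componentwise[OF has_derivative_linear[OF f'[OF that]], of h 1]
    by (simp add: dir_deriv_def)
  moreover have "continuous_on S (\<lambda>p. \<Sum>b\<in>Basis. (h \<bullet> b) * dir_deriv S b f p)" for h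
    by (intro continuous_intros cont)
  ultimately have "continuous_on S (\<lambda>p. ?f' p h)" for h
    by (metis (no_types, lifting) continuous_on_cong)
  with f' show ?thesis unfolding C1_on_def by (intro exI[of _ ?f'] conjI ballI allI)
qed

section \<open>A local energy estimate\<close>

lemma slab_iff: "p \<in> slab T \<longleftrightarrow> 0 \<le> fst p \<and> fst p \<le> T"
  by (cases p) (simp add: slab_def)

lemma frechet_derivative_slab:
  assumes T: "0 < T" and p: "p \<in> slab T" and f: "(f has_derivative f') (at p within slab T)"
  shows "frechet_derivative f (at p within slab T) = f'"
proof (rule frechet_derivative_unique_within)
  show "(f has_derivative frechet_derivative f (at p within slab T)) (at p within slab T)"
    using f by (auto simp: differentiable_def simp flip: frechet_derivative_works)
  show "(f has_derivative f') (at p within slab T)" by (fact f)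
  fix b :: "real \<times> (real ^ 'a)" and \<epsilon> :: real
  assume b: "b \<in> Basis" and \<epsilon>: "0 < \<epsilon>"
  \<comment> \<open>A step in time has to point into the slab; a step in space may go either way.\<close>
  define \<delta> where "\<delta> = (if fst p \<le> T / 2 then min (\<epsilon> / 2) (T / 2) else - min (\<epsilon> / 2) (T / 2))"
  have "0 < \<bar>\<delta>\<bar>" "\<bar>\<delta>\<bar> < \<epsilon>" "0 \<le> fst p + \<delta>" "fst p + \<delta> \<le> T"
    using T p \<epsilon> by (auto simp: \<delta>_def slab_iff)
  moreover have "fst b = 1 \<or> fst b = 0" using b by (auto simp: Basis_prod_def)
  ultimately show "\<exists>d. 0 < \<bar>d\<bar> \<and> \<bar>d\<bar> < \<epsilon> \<and> p + d *\<^sub>R b \<in> slab T"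
    using p by (intro exI[of _ \<delta>]) (auto simp: slab_iff)
qed

lemma dt_eq: "0 < T \<Longrightarrow> p \<in> slab T \<Longrightarrow> (f has_derivative f') (at p within slab T) \<Longrightarrow> dt T f p = f' (1, 0)"
  and dx_eq: "0 < T \<Longrightarrow> p \<in> slab T \<Longrightarrow> (f has_derivative f') (at p within slab T) \<Longrightarrow> dx T i f p = f' (0, axis i 1)"
  by (simp_all add: dt_def dx_def dir_deriv_def frechet_derivative_slab)

text \<open>
  The integral of \<open>h\<close> is invariant under translations; its derivative in the direction of a
  translation is the integral of the directional derivative.
\<close>

lemma integral_directional_derivative_compact_support:
  fixes h :: "'a::euclidean_space \<Rightarrow> real"
  assumes h: "\<And>x. (h has_derivative h' x) (at x)"
    and cont: "continuous_on UNIV (\<lambda>x. h' x u)"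
    and supp: "\<And>x. R < dist y x \<Longrightarrow> h x = 0"
    and box: "cball y (R + norm u) \<subseteq> cbox a b"
  shows "integral (cbox a b) (\<lambda>x. h' x u) = 0"
proof -
  define \<Phi> where "\<Phi> s = integral (cbox a b) (\<lambda>x. h (x + s *\<^sub>R u))" for s :: real
  have conth: "continuous_on S h" for S
    using h by (meson continuous_at_imp_continuous_on has_derivative_continuous)
  have \<Phi>_deriv: "(\<Phi> has_field_derivative integral (cbox a b) (\<lambda>x. h' (x + 0 *\<^sub>R u) u)) (at 0 within {-1<..<1})"
    unfolding \<Phi>_def
  proof (rule leibniz_rule_field_derivative[where fx = "\<lambda>s x. h' (x + s *\<^sub>R u) u"])
    fix s :: real and x
    have "((\<lambda>s. h (x + s *\<^sub>R u)) has_derivative (\<lambda>r. h' (x + s *\<^sub>R u) (r *\<^sub>R u))) (at s within {-1<..<1})"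
      by (rule has_derivative_compose[OF _ h, of "\<lambda>s. x + s *\<^sub>R u"]) (auto intro!: derivative_eq_intros)
    moreover have "h' (x + s *\<^sub>R u) (r *\<^sub>R u) = r * h' (x + s *\<^sub>R u) u" for r
      using linear_scale[OF has_derivative_linear[OF h]] by simp
    ultimately show "((\<lambda>s. h (x + s *\<^sub>R u)) has_field_derivative h' (x + s *\<^sub>R u) u) (at s within {-1<..<1})"
      by (simp add: has_field_derivative_def mult_commute_abs)
  next
    fix s :: real
    show "(\<lambda>x. h (x + s *\<^sub>R u)) integrable_on cbox a b"
      by (intro integrable_continuous continuous_intros continuous_on_compose2[OF conth[of UNIV]]) auto
  next
    show "continuous_on ({-1<..<1} \<times> cbox a b) (\<lambda>(s, x). h' (x + s *\<^sub>R u) u)"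
      unfolding case_prod_beta by (intro continuous_intros continuous_on_compose2[OF cont]) auto
  qed auto
  have "\<Phi> s = integral UNIV h" if "s \<in> {-1<..<1}" for s
  proof -
    have "x \<in> cbox (a + s *\<^sub>R u) (b + s *\<^sub>R u)" if "h x \<noteq> 0" for x
    proof -
      have "norm (s *\<^sub>R u) \<le> norm u" using \<open>s \<in> {-1<..<1}\<close> by (auto intro!: mult_left_le_one_le)
      moreover have "dist y x \<le> R" using supp[of x] that by force
      ultimately have "dist y (x - s *\<^sub>R u) \<le> R + norm u"
        using dist_triangle[of y "x - s *\<^sub>R u" x] by (simp add: dist_norm[of x])
      then have "x - s *\<^sub>R u \<in> cbox a b" using box by auto
      then show ?thesis by (auto simp: mem_box algebra_simps)
    qed
    then have "(\<lambda>x. if x \<in> cbox (a + s *\<^sub>R u) (b + s *\<^sub>R u) then h x else 0) = h" by fastforce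
    then have "integral UNIV h = integral (cbox (a + s *\<^sub>R u) (b + s *\<^sub>R u)) h"
      using Henstock_Kurzweil_Integration.integral_restrict_UNIV[of "cbox (a + s *\<^sub>R u) (b + s *\<^sub>R u)" h] by simp
    then show ?thesis
      using integral_shift_cbox_plus[of a b h "s *\<^sub>R u"] by (simp add: \<Phi>_def o_def add.commute)
  qed
  note \<Phi>_const = this
  have "at (0::real) within {-1<..<1} = at 0" by (rule at_within_open) auto
  with \<Phi>_deriv have "(\<Phi> has_field_derivative integral (cbox a b) (\<lambda>x. h' x u)) (at 0)" by simp
  then have "((\<lambda>_. integral UNIV h) has_field_derivative integral (cbox a b) (\<lambda>x. h' x u)) (at 0)"
    by (rule has_field_derivative_transform_within_open[of _ _ _ "{-1<..<1}"]) (auto simp: \<Phi>_const)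
  from DERIV_unique[OF this DERIV_const] show ?thesis .
qed

lemma has_real_derivative_square_pos_part:
  "((\<lambda>s. (max 0 s)\<^sup>2) has_real_derivative 2 * max 0 s) (at s)"
proof (cases s "0::real" rule: linorder_cases)
  case less
  have "((\<lambda>s::real. 0) has_real_derivative 0) (at s)" by simp
  then have "((\<lambda>s. (max 0 s)\<^sup>2) has_real_derivative 0) (at s)"
    by (rule has_field_derivative_transform_within_open[of _ _ _ "{..<0}"]) (use less in auto)
  with less show ?thesis by simp
next
  case equal
  have "((\<lambda>h::real. (max 0 h)\<^sup>2 / h) \<longlongrightarrow> 0) (at 0)"
  proof (rule Lim_null_comparison)
    show "\<forall>\<^sub>F h in at 0. norm ((max 0 h)\<^sup>2 / h) \<le> \<bar>h\<bar>"
      by (rule always_eventually) (auto simp: max_def power2_eq_square)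
    show "((\<lambda>h::real. \<bar>h\<bar>) \<longlongrightarrow> 0) (at 0)" by (auto intro!: tendsto_eq_intros)
  qed
  with equal show ?thesis by (simp add: DERIV_def)
next
  case greater
  have "((\<lambda>s::real. s\<^sup>2) has_real_derivative 2 * s) (at s)" by (auto intro!: derivative_eq_intros)
  then have "((\<lambda>s. (max 0 s)\<^sup>2) has_real_derivative 2 * s) (at s)"
    by (rule has_field_derivative_transform_within_open[of _ _ _ "{0<..}"]) (use greater in auto)
  with greater show ?thesis by simp
qed

text \<open>
  Positive inside a region whose section at time \<open>t\<close> shrinks at least at speed \<open>c\<close>. The regularised
  norm \<open>sqrt (1 + |x - x0|\<^sup>2)\<close> is smooth with gradient of length less than 1. The square of the
  positive part is a continuously differentiable weight of compact support.
\<close>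

definition cone_weight :: "real \<Rightarrow> real \<Rightarrow> 'a::real_inner \<Rightarrow> real \<times> 'a \<Rightarrow> real" where
  "cone_weight R c x0 p = R - c * fst p - sqrt (1 + (snd p - x0) \<bullet> (snd p - x0))"

lemma cone_weight_derivative:
  "((\<lambda>p. (max 0 (cone_weight R c x0 p))\<^sup>2) has_derivative
     (\<lambda>h. 2 * max 0 (cone_weight R c x0 p) *
       (- c * fst h - (snd p - x0) \<bullet> snd h / sqrt (1 + (snd p - x0) \<bullet> (snd p - x0))))) (at p within S)"
proof -
  have pos: "0 < 1 + (snd p - x0) \<bullet> (snd p - x0)" by (simp add: add_pos_nonneg)
  have "(cone_weight R c x0 has_derivative
       (\<lambda>h. - c * fst h - (snd p - x0) \<bullet> snd h / sqrt (1 + (snd p - x0) \<bullet> (snd p - x0)))) (at p within S)"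
    unfolding cone_weight_def[abs_def]
    using pos by (auto intro!: derivative_eq_intros simp: fun_eq_iff inner_commute field_simps)
  from has_derivative_compose[OF this, of "\<lambda>s. (max 0 s)\<^sup>2", OF
      has_real_derivative_square_pos_part[unfolded has_field_derivative_def]]
  show ?thesis by simp
qed

lemma cone_weight_cont: "continuous_on S (cone_weight R c x0)"
  unfolding cone_weight_def by (intro continuous_intros)

text \<open>
  With the weight \<open>\<psi>\<close>, integration by parts gives
  \<open>d/dt \<integral> \<psi> e \<le> \<integral> (\<partial>\<^sub>t \<psi> e - \<partial>\<^sub>j \<psi> f\<^sub>j) + C \<integral> \<psi> e\<close>, and the first integrand is not positive if the cone
  shrinks faster than the flux can carry \<open>e\<close>. Gronwall's inequality concludes. The cone is
  chosen so large that \<open>\<psi>\<close> is positive at the given point.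
\<close>

lemma local_energy_uniqueness:
  fixes e :: "'n::finite field" and f :: "'n \<Rightarrow> 'n field"
  assumes T: "0 < T" and e: "C1_on (slab T) e" and f: "\<And>j. C1_on (slab T) (f j)"
    and nonneg: "\<And>p. p \<in> slab T \<Longrightarrow> 0 \<le> e p"
    and flux: "\<And>j p. p \<in> slab T \<Longrightarrow> \<bar>f j p\<bar> \<le> V * e p"
    and balance: "\<And>p. p \<in> slab T \<Longrightarrow> dt T e p \<le> (\<Sum>j\<in>UNIV. dx T j (f j) p) + C * e p"
    and init: "\<And>x. e (0, x) = 0"
    and p0: "p0 \<in> slab T"
  shows "e p0 = 0"
proof -
  obtain t0 x0 where p0_eq: "p0 = (t0, x0)" and t0: "0 \<le> t0" "t0 \<le> T"
    using p0 by (cases p0) (auto simp: slab_iff)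
  obtain e' where e': "\<And>p. p \<in> slab T \<Longrightarrow> (e has_derivative e' p) (at p within slab T)"
    "\<And>h. continuous_on (slab T) (\<lambda>p. e' p h)"
    using e unfolding C1_on_def by blast
  obtain f' where f': "\<And>j p. p \<in> slab T \<Longrightarrow> (f j has_derivative f' j p) (at p within slab T)"
    "\<And>j h. continuous_on (slab T) (\<lambda>p. f' j p h)"
    using f unfolding C1_on_def by metis
  have e_cont: "continuous_on (slab T) e" and f_cont: "continuous_on (slab T) (f j)" for j
    using e' f' has_derivative_continuous_on by blast+
  \<comment> \<open>Each of the \<open>CARD('n)\<close> flux components moves at speed at most \<open>V\<close>.
      With this \<open>R\<close> the weight is at least 1 at \<open>(t0, x0)\<close>.\<close>
  define c where "c = CARD('n) * max V 0"
  define R where "R = 2 + c * T"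
  define \<psi> where "\<psi> p = (max 0 (cone_weight R c x0 p))\<^sup>2" for p :: "'n spacetime"
  define \<psi>' where "\<psi>' p h = 2 * max 0 (cone_weight R c x0 p) *
       (- c * fst h - (snd p - x0) \<bullet> snd h / sqrt (1 + (snd p - x0) \<bullet> (snd p - x0)))" for p h :: "'n spacetime"
  have \<psi>_deriv: "(\<psi> has_derivative \<psi>' p) (at p within S)" for p S
    unfolding \<psi>_def[abs_def] \<psi>'_def[abs_def] by (rule cone_weight_derivative)
  have \<psi>_cont: "continuous_on S \<psi>" for S
    unfolding \<psi>_def by (intro continuous_intros cone_weight_cont)
  have sqrt_pos: "0 < sqrt (1 + y \<bullet> y)" for y :: "real ^ 'n"
    by (simp add: add_pos_nonneg)
  have \<psi>'_cont: "continuous_on S (\<lambda>p. \<psi>' p h)" for S h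
    unfolding \<psi>'_def using sqrt_pos by (intro continuous_intros cone_weight_cont) (metis less_irrefl)
  have c0: "0 \<le> c" by (simp add: c_def)
  have \<psi>_supp: "\<psi> (t, x) = 0" if "0 \<le> t" "R < dist x0 x" for t x
  proof -
    have "norm (x - x0) \<le> sqrt (1 + (x - x0) \<bullet> (x - x0))"
      unfolding norm_eq_sqrt_inner by (intro real_sqrt_le_mono) simp
    moreover have "0 \<le> c * t" using that c0 by simp
    ultimately have "cone_weight R c x0 (t, x) \<le> 0"
      using that by (simp add: cone_weight_def dist_norm norm_minus_commute)
    then show ?thesis by (simp add: \<psi>_def max_def)
  qed
  have \<psi>_decreasing: "\<psi>' p (1, 0) * e p - (\<Sum>j\<in>UNIV. \<psi>' p (0, axis j 1) * f j p) \<le> 0" if p: "p \<in> slab T" for p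
  proof -
    define M where "M = 2 * max 0 (cone_weight R c x0 p)"
    have "- (\<psi>' p (0, axis j 1) * f j p) \<le> M * (max V 0 * e p)" for j
    proof -
      define q where "q = (snd p - x0) \<bullet> axis j 1 / sqrt (1 + (snd p - x0) \<bullet> (snd p - x0))"
      have "\<bar>(snd p - x0) \<bullet> axis j 1\<bar> \<le> norm (snd p - x0)"
        using Cauchy_Schwarz_ineq2[of "snd p - x0" "axis j 1"] by simp
      also have "\<dots> \<le> sqrt (1 + (snd p - x0) \<bullet> (snd p - x0))"
        unfolding norm_eq_sqrt_inner by (intro real_sqrt_le_mono) simp
      finally have q: "\<bar>q\<bar> \<le> 1"
        unfolding q_def abs_divide using sqrt_pos[of "snd p - x0"]
          by (simp add: abs_of_pos divide_le_eq_1_pos del: real_sqrt_gt_0_iff real_sqrt_lt_1_iff)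
      have "\<bar>f j p\<bar> \<le> max V 0 * e p"
        using flux[OF p, of j] nonneg[OF p] by (smt (verit) mult_right_mono)
      then have "\<bar>q\<bar> * \<bar>f j p\<bar> \<le> max V 0 * e p"
        using q by (smt (verit) abs_ge_zero mult_left_le_one_le)
      then have "q * f j p \<le> max V 0 * e p" using abs_ge_self[of "q * f j p"] by (simp add: abs_mult)
      moreover have "- (\<psi>' p (0, axis j 1) * f j p) = M * (q * f j p)"
        by (simp add: \<psi>'_def M_def q_def)
      moreover have "0 \<le> M" by (simp add: M_def)
      ultimately show ?thesis by (simp add: mult_left_mono)
    qed
    then have "(\<Sum>j\<in>UNIV. - (\<psi>' p (0, axis j 1) * f j p)) \<le> (\<Sum>j\<in>(UNIV::'n set). M * (max V 0 * e p))"
      by (intro sum_mono)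
    also have "\<dots> = - (\<psi>' p (1, 0) * e p)" by (simp add: \<psi>'_def M_def c_def)
    finally show ?thesis by (simp add: sum_negf)
  qed
  obtain b where b: "cball x0 (R + 1) \<subseteq> box (-b) b"
    using bounded_subset_box_symmetric[OF bounded_cball] by blast
  then have b': "cball x0 (R + 1) \<subseteq> cbox (-b) b" using box_subset_cbox by blast
  have R0: "0 \<le> R" using c0 T by (simp add: R_def)
  define E where "E t = integral (cbox (-b) b) (\<lambda>x. \<psi> (t, x) * e (t, x))" for t
  define E' where "E' t = integral (cbox (-b) b) (\<lambda>x. \<psi> (t, x) * e' (t, x) (1, 0) + \<psi>' (t, x) (1, 0) * e (t, x))" for t
  have slice: "continuous_on X (\<lambda>x. g (t, x))" if "continuous_on (slab T) g" "t \<in> {0..T}"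
    for g :: "'n field" and t X
    by (rule continuous_on_compose2[OF that(1)]) (use that(2) in \<open>auto simp: slab_iff intro!: continuous_intros\<close>)
  have E_deriv: "(E has_real_derivative E' t) (at t within {0..T})" if t: "t \<in> {0..T}" for t
    unfolding E_def E'_def
  proof (rule leibniz_rule_field_derivative[where fx = "\<lambda>t x. \<psi> (t, x) * e' (t, x) (1, 0) + \<psi>' (t, x) (1, 0) * e (t, x)"])
    fix s x assume s: "s \<in> {0..T}"
    have "((\<lambda>p. \<psi> p * e p) has_derivative (\<lambda>h. \<psi> (s, x) * e' (s, x) h + \<psi>' (s, x) h * e (s, x))) (at (s, x) within slab T)"
      using s by (intro has_derivative_mult \<psi>_deriv e') (simp add: slab_iff)
    then have A: "((\<lambda>p. \<psi> p * e p) has_derivative (\<lambda>h. \<psi> (s, x) * e' (s, x) h + \<psi>' (s, x) h * e (s, x)))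
        (at (s, x) within (\<lambda>s. (s, x)) ` {0..T})"
      by (rule has_derivative_subset) (auto simp: slab_iff)
    have B: "((\<lambda>s. (s, x)) has_derivative (\<lambda>r. (r, 0))) (at s within {0..T})"
      by (auto intro!: derivative_eq_intros)
    have C: "((\<lambda>s. \<psi> (s, x) * e (s, x)) has_derivative
        (\<lambda>r. \<psi> (s, x) * e' (s, x) (r, 0) + \<psi>' (s, x) (r, 0) * e (s, x))) (at s within {0..T})"
      using diff_chain_within[OF B A] by (simp add: o_def)
    have scale: "e' (s, x) (r, 0) = r * e' (s, x) (1, 0)" "\<psi>' (s, x) (r, 0) = r * \<psi>' (s, x) (1, 0)" for r
      using linear_scale[OF has_derivative_linear[OF e'(1)[of "(s, x)"]], of r "(1, 0)"]
        linear_scale[OF has_derivative_linear[OF \<psi>_deriv[of "(s, x)" UNIV]], of r "(1, 0)"] s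
      by (simp_all add: slab_iff)
    have eq: "\<psi> (s, x) * e' (s, x) (r, 0) + \<psi>' (s, x) (r, 0) * e (s, x)
        = (\<psi> (s, x) * e' (s, x) (1, 0) + \<psi>' (s, x) (1, 0) * e (s, x)) * r" for r
      unfolding scale[of r] by (simp only: algebra_simps)
    show "((\<lambda>s. \<psi> (s, x) * e (s, x)) has_field_derivative
        (\<psi> (s, x) * e' (s, x) (1, 0) + \<psi>' (s, x) (1, 0) * e (s, x))) (at s within {0..T})"
      unfolding has_field_derivative_def by (rule has_derivative_eq_rhs[OF C]) (rule ext, rule eq)
  next
    fix s assume "s \<in> {0..T}"
    then show "(\<lambda>x. \<psi> (s, x) * e (s, x)) integrable_on cbox (-b) b"
      by (intro integrable_continuous continuous_intros slice \<psi>_cont e_cont)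
  next
    show "continuous_on ({0..T} \<times> cbox (-b) b)
       (\<lambda>(t, x). \<psi> (t, x) * e' (t, x) (1, 0) + \<psi>' (t, x) (1, 0) * e (t, x))"
      unfolding case_prod_beta prod.collapse
      by (intro continuous_intros \<psi>_cont \<psi>'_cont continuous_on_subset[OF e_cont] continuous_on_subset[OF e'(2)])
         (auto simp: slab_iff)
  qed (use t in auto)
  have parts: "integral (cbox (-b) b) (\<lambda>x. \<psi> (t, x) * f' j (t, x) (0, axis j 1) + \<psi>' (t, x) (0, axis j 1) * f j (t, x)) = 0"
    if t: "t \<in> {0..T}" for t j
  proof (rule integral_directional_derivative_compact_support
      [where h = "\<lambda>x. \<psi> (t, x) * f j (t, x)" and u = "axis j 1" and R = R and y = x0
        and h' = "\<lambda>x k. \<psi> (t, x) * f' j (t, x) (0, k) + \<psi>' (t, x) (0, k) * f j (t, x)"])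
    fix x
    have "((\<lambda>p. \<psi> p * f j p) has_derivative (\<lambda>h. \<psi> (t, x) * f' j (t, x) h + \<psi>' (t, x) h * f j (t, x))) (at (t, x) within slab T)"
      using t by (intro has_derivative_mult \<psi>_deriv f') (simp add: slab_iff)
    then have A: "((\<lambda>p. \<psi> p * f j p) has_derivative (\<lambda>h. \<psi> (t, x) * f' j (t, x) h + \<psi>' (t, x) h * f j (t, x)))
        (at (t, x) within (\<lambda>x. (t, x)) ` UNIV)"
      by (rule has_derivative_subset) (use t in \<open>auto simp: slab_iff\<close>)
    have B: "((\<lambda>x. (t, x)) has_derivative (\<lambda>k. (0, k))) (at x)"
      by (auto intro!: derivative_eq_intros)
    show "((\<lambda>x. \<psi> (t, x) * f j (t, x)) has_derivative
        (\<lambda>k. \<psi> (t, x) * f' j (t, x) (0, k) + \<psi>' (t, x) (0, k) * f j (t, x))) (at x)"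
      using diff_chain_within[OF B A] by (simp add: o_def)
  next
    show "continuous_on UNIV (\<lambda>x. \<psi> (t, x) * f' j (t, x) (0, axis j 1) + \<psi>' (t, x) (0, axis j 1) * f j (t, x))"
      using t by (intro continuous_intros slice \<psi>_cont \<psi>'_cont f_cont f')
  next
    show "\<psi> (t, x) * f j (t, x) = 0" if "R < dist x0 x" for x
      using \<psi>_supp[of t x] t that by simp
  qed (use b' in auto)
  have E_ineq: "E' t \<le> C * E t" if t: "t \<in> {0..T}" for t
  proof -
    have div_int: "(\<lambda>x. \<psi> (t, x) * f' j (t, x) (0, axis j 1) + \<psi>' (t, x) (0, axis j 1) * f j (t, x)) integrable_on cbox (-b) b" for j
      using t by (intro integrable_continuous continuous_intros slice \<psi>_cont \<psi>'_cont f_cont f')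
    have e_int: "(\<lambda>x. C * (\<psi> (t, x) * e (t, x))) integrable_on cbox (-b) b"
      using t by (intro integrable_continuous continuous_intros slice \<psi>_cont e_cont)
    have "E' t \<le> integral (cbox (-b) b) (\<lambda>x. C * (\<psi> (t, x) * e (t, x)) +
       (\<Sum>j\<in>UNIV. \<psi> (t, x) * f' j (t, x) (0, axis j 1) + \<psi>' (t, x) (0, axis j 1) * f j (t, x)))"
      unfolding E'_def
    proof (rule integral_le)
      show "(\<lambda>x. \<psi> (t, x) * e' (t, x) (1, 0) + \<psi>' (t, x) (1, 0) * e (t, x)) integrable_on cbox (-b) b"
        using t by (intro integrable_continuous continuous_intros slice \<psi>_cont \<psi>'_cont e_cont e')
      show "(\<lambda>x. C * (\<psi> (t, x) * e (t, x)) +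
       (\<Sum>j\<in>UNIV. \<psi> (t, x) * f' j (t, x) (0, axis j 1) + \<psi>' (t, x) (0, axis j 1) * f j (t, x))) integrable_on cbox (-b) b"
        by (intro integrable_add integrable_sum e_int div_int) auto
      fix x :: "real ^ 'n"
      have tx: "(t, x) \<in> slab T" using t by (simp add: slab_iff)
      have "e' (t, x) (1, 0) \<le> (\<Sum>j\<in>UNIV. f' j (t, x) (0, axis j 1)) + C * e (t, x)"
        using balance[OF tx] by (simp add: dt_eq[OF T tx e'(1)[OF tx]] dx_eq[OF T tx f'(1)[OF tx]])
      then have "\<psi> (t, x) * e' (t, x) (1, 0) \<le> \<psi> (t, x) * ((\<Sum>j\<in>UNIV. f' j (t, x) (0, axis j 1)) + C * e (t, x))"
        by (rule mult_left_mono) (simp add: \<psi>_def)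
      then show "\<psi> (t, x) * e' (t, x) (1, 0) + \<psi>' (t, x) (1, 0) * e (t, x) \<le> C * (\<psi> (t, x) * e (t, x)) +
       (\<Sum>j\<in>UNIV. \<psi> (t, x) * f' j (t, x) (0, axis j 1) + \<psi>' (t, x) (0, axis j 1) * f j (t, x))"
        using \<psi>_decreasing[OF tx] by (simp add: sum.distrib algebra_simps sum_distrib_left sum_distrib_right)
    qed
    also have "\<dots> = C * E t"
      using e_int div_int by (subst integral_add) (auto simp: integral_sum parts[OF t] E_def intro!: integrable_sum)
    finally show ?thesis .
  qed
  \<comment> \<open>Gronwall: this quantity does not increase.\<close>
  define G where "G t = exp (- C * t) * E t" for t
  have G_deriv: "(G has_real_derivative exp (- C * t) * (E' t - C * E t)) (at t within {0..T})" if "t \<in> {0..T}" for t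
    unfolding G_def[abs_def] by (rule derivative_eq_intros E_deriv[OF that] refl | simp add: algebra_simps)+
  have "G 0 \<ge> G t0"
  proof (rule DERIV_nonpos_imp_decreasing_open[OF t0(1)])
    fix t assume t: "0 < t" "t < t0"
    then have "t \<in> {0..T}" "at t within {0..T} = at t"
      using t0 by (auto intro!: at_within_interior)
    with G_deriv[of t] E_ineq[of t] show "\<exists>y. (G has_real_derivative y) (at t) \<and> y \<le> 0"
      by (intro exI[of _ "exp (- C * t) * (E' t - C * E t)"]) (auto simp: mult_le_0_iff)
  next
    have "continuous_on {0..T} G"
      by (rule DERIV_continuous_on[OF G_deriv])
    then show "continuous_on {0..t0} G" by (rule continuous_on_subset) (use t0 in auto)
  qed
  moreover have "G 0 = 0" by (simp add: G_def E_def init)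
  ultimately have "E t0 \<le> 0" by (simp add: G_def mult_le_0_iff)
  have \<psi>e_cont: "continuous_on (cbox (-b) b) (\<lambda>x. \<psi> (t0, x) * e (t0, x))"
    using t0 by (intro continuous_intros slice \<psi>_cont e_cont) auto
  have \<psi>e_nonneg: "0 \<le> \<psi> (t0, x) * e (t0, x)" for x
    using nonneg[of "(t0, x)"] t0 by (simp add: \<psi>_def slab_iff)
  have "0 \<le> E t0" unfolding E_def
    by (rule integral_nonneg[OF integrable_continuous[OF \<psi>e_cont] \<psi>e_nonneg])
  with \<open>E t0 \<le> 0\<close> have "integral (cbox (-b) b) (\<lambda>x. \<psi> (t0, x) * e (t0, x)) = 0" by (simp add: E_def)
  moreover have x0_box: "x0 \<in> box (-b) b" using b R0 by (auto intro: subsetD)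
  ultimately have "\<psi> (t0, x0) * e (t0, x0) = 0"
    using integral_cbox_eq_0_iff[OF \<psi>e_cont _ \<psi>e_nonneg] box_subset_cbox by blast
  moreover have "\<psi> (t0, x0) \<noteq> 0"
  proof -
    have "c * t0 \<le> c * T" using c0 t0 by (simp add: mult_left_mono)
    then have "1 \<le> cone_weight R c x0 (t0, x0)" by (simp add: cone_weight_def R_def)
    then show ?thesis by (simp add: \<psi>_def)
  qed
  ultimately show ?thesis by (simp add: p0_eq)
qed

text \<open>
  Transport by a bounded field with bounded divergence contributes the flux \<open>- v\<^sub>j e\<close> and a
  zeroth-order term.
\<close>

lemma transport_energy_uniqueness:
  fixes e :: "'n::finite field" and g v :: "'n \<Rightarrow> 'n field"
  assumes T: "0 < T" and e: "C1_on (slab T) e" and g: "\<And>j. C1_on (slab T) (g j)"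
    and v: "\<And>j. C1_on (slab T) (v j)"
    and nonneg: "\<And>p. p \<in> slab T \<Longrightarrow> 0 \<le> e p"
    and flux: "\<And>j p. p \<in> slab T \<Longrightarrow> \<bar>g j p\<bar> \<le> B * e p"
    and v_le: "\<And>j p. p \<in> slab T \<Longrightarrow> \<bar>v j p\<bar> \<le> B"
    and dv_le: "\<And>j p. p \<in> slab T \<Longrightarrow> \<bar>dx T j (v j) p\<bar> \<le> B"
    and balance: "\<And>p. p \<in> slab T \<Longrightarrow> dt T e p + (\<Sum>j\<in>UNIV. v j p * dx T j e p)
         \<le> (\<Sum>j\<in>UNIV. dx T j (g j) p) + C * e p"
    and init: "\<And>x. e (0, x) = 0"
    and p0: "p0 \<in> slab T"
  shows "e p0 = 0"
proof (rule local_energy_uniqueness[OF T e _ nonneg _ _ init p0, where f = "\<lambda>j p. g j p - v j p * e p"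
      and V = "2 * B" and C = "C + CARD('n) * B"])
  show "C1_on (slab T) (\<lambda>p. g j p - v j p * e p)" for j
    by (intro C1_on_intros g v e)
  show "\<bar>g j p - v j p * e p\<bar> \<le> 2 * B * e p" if p: "p \<in> slab T" for j p
  proof -
    have "\<bar>v j p * e p\<bar> \<le> B * e p"
      using v_le[OF p, of j] nonneg[OF p] by (simp add: abs_mult mult_right_mono)
    with flux[OF p, of j] show ?thesis by simp
  qed
  fix p :: "'n spacetime" assume p: "p \<in> slab T"
  have "dx T j (\<lambda>p. g j p - v j p * e p) p = dx T j (g j) p - v j p * dx T j e p - dx T j (v j) p * e p" for j
    unfolding dx_def dir_deriv_def
    by (subst frechet_derivative_slab[OF T p])
       (rule has_derivative_diff has_derivative_mult C1_on_has_derivative g v e p | simp)+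
  then have "(\<Sum>j\<in>UNIV. dx T j (\<lambda>p. g j p - v j p * e p) p) = (\<Sum>j\<in>UNIV. dx T j (g j) p)
      - (\<Sum>j\<in>UNIV. v j p * dx T j e p) - (\<Sum>j\<in>UNIV. dx T j (v j) p * e p)"
    by (simp add: sum_subtractf)
  moreover have "(\<Sum>j\<in>UNIV. dx T j (v j) p * e p) \<le> (\<Sum>j\<in>(UNIV :: 'n set). B * e p)"
    using dv_le[OF p] nonneg[OF p] by (intro sum_mono mult_right_mono) (auto intro: order_trans[OF abs_ge_self])
  ultimately show "dt T e p \<le> (\<Sum>j\<in>UNIV. dx T j (\<lambda>p. g j p - v j p * e p) p) + (C + CARD('n) * B) * e p"
    using balance[OF p] by (simp add: algebra_simps)
qed

section \<open>The system in Fock space\<close>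

lemma idx_iff: "(A, I) \<in> (idx :: ('m::finite set \<times> 'n::finite set) set) \<longleftrightarrow> card A = card I \<and> A \<noteq> {}"
  using card_mono[of "UNIV :: 'm set" A] card_mono[of "UNIV :: 'n set" I]
  by (auto simp: idx_def Suc_le_eq card_gt_0_iff)

text \<open>
  Only the balanced entries carry data; setting the others to zero makes every sum over pairs of the
  system an unrestricted sum.
\<close>

definition fock_field ::
  "'n::finite field \<Rightarrow> ('m::finite set \<Rightarrow> 'n set \<Rightarrow> 'n field) \<Rightarrow> 'n spacetime \<Rightarrow> ('m, 'n) fock" where
  "fock_field \<tau> m p = (\<chi> q. case q of (A, I) \<Rightarrow> if card A = card I then mext \<tau> m A I p else 0)"

lemma fock_field_nth: "fock_field \<tau> m p $ (A, I) = (if card A = card I then mext \<tau> m A I p else 0)"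
  by (simp add: fock_field_def)

lemma inner_balanced:
  fixes x y :: "('m::finite, 'n::finite) fock"
  assumes "\<And>A I. card A \<noteq> card I \<Longrightarrow> x $ (A, I) * y $ (A, I) = 0"
  shows "x \<bullet> y = x $ ({}, {}) * y $ ({}, {}) + (\<Sum>(A, I)\<in>idx. x $ (A, I) * y $ (A, I))"
proof -
  have "x \<bullet> y = (\<Sum>q\<in>insert ({}, {}) idx. x $ q * y $ q)"
    unfolding inner_vec_def inner_real_def
  proof (rule sum.mono_neutral_right)
    show "\<forall>q\<in>UNIV - insert ({}, {}) idx. x $ q * y $ q = 0"
    proof
      fix q :: "'m set \<times> 'n set" assume q: "q \<in> UNIV - insert ({}, {}) idx"
      obtain A I where "q = (A, I)" by fastforce
      with q assms[of A I] show "x $ q * y $ q = 0"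
        by (cases "card A = card I") (auto simp: idx_iff)
    qed
  qed auto
  also have "\<dots> = x $ ({}, {}) * y $ ({}, {}) + (\<Sum>q\<in>idx. x $ q * y $ q)"
    by (subst sum.insert) (auto simp: idx_iff)
  finally show ?thesis by (simp add: case_prod_beta)
qed

lemma shear_nth:
  "shear P x $ (A, I) = (\<Sum>i\<in>I. \<Sum>k | k \<notin> I - {i}.
     P i k * (pos_sign I i * (pos_sign (I - {i}) k * x $ (A, insert k (I - {i})))))"
proof -
  have "shear P x $ (A, I) = (\<Sum>i\<in>UNIV. if i \<in> I then \<Sum>k\<in>UNIV. if k \<notin> I - {i} then
      P i k * (pos_sign I i * (pos_sign (I - {i}) k * x $ (A, insert k (I - {i})))) else 0 else 0)"
    unfolding shear_def sum_component
    by (intro sum.cong refl) (auto simp: fock_nth intro!: sum.cong)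
  then show ?thesis by (simp add: sum.If_cases)
qed

lemma source_nth:
  "source S x $ (A, I) = (\<Sum>\<alpha>\<in>A. \<Sum>i\<in>I.
     S \<alpha> i * (pos_sign A \<alpha> * (pos_sign I i * x $ (A - {\<alpha>}, I - {i}))))"
proof -
  have "source S x $ (A, I) = (\<Sum>\<alpha>\<in>UNIV. if \<alpha> \<in> A then \<Sum>i\<in>UNIV. if i \<in> I then
      S \<alpha> i * (pos_sign A \<alpha> * (pos_sign I i * x $ (A - {\<alpha>}, I - {i}))) else 0 else 0)"
    unfolding source_def sum_component
    by (intro sum.cong refl) (auto simp: fock_nth intro!: sum.cong)
  then show ?thesis by (simp add: sum.If_cases)
qed

lemma has_derivative_vec_nth_components:
  fixes f :: "'a::real_normed_vector \<Rightarrow> real ^ 'k::finite"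
  assumes "\<And>q. ((\<lambda>p. f p $ q) has_derivative (\<lambda>h. f' h $ q)) F"
  shows "(f has_derivative f') F"
proof -
  have eq: "g = (\<lambda>p. \<Sum>q\<in>UNIV. g p $ q *\<^sub>R axis q 1)" for g :: "'b \<Rightarrow> real ^ 'k"
    by (auto simp: Finite_Cartesian_Product.vec_eq_iff axis_def if_distrib[of "(*) _"] cong: if_cong)
  have "((\<lambda>p. \<Sum>q\<in>UNIV. f p $ q *\<^sub>R axis q (1::real)) has_derivative (\<lambda>h. \<Sum>q\<in>UNIV. f' h $ q *\<^sub>R axis q 1)) F"
    by (intro has_derivative_sum has_derivative_scaleR_left assms)
  then show ?thesis using eq[of f] eq[of f'] by simp
qed

text \<open>
  Throughout, derivatives are taken within the slab, and vector-valued fields are differentiated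
  entrywise. The operator \<open>D\<close> of the introduction is the derivative along \<open>transport_dir\<close>.
\<close>

locale smooth_solution =
  fixes T :: real
    and \<tau> :: "'n::{finite,linorder} field"
    and d :: "'m::{finite,linorder} \<Rightarrow> 'n field"
    and v :: "'n \<Rightarrow> 'n field"
    and m :: "'m set \<Rightarrow> 'n set \<Rightarrow> 'n field"
  assumes T: "0 < T" and sol: "smooth_solution_N T \<tau> d v m"
begin

abbreviation "\<mu> \<equiv> fock_field \<tau> m"

definition deriv_along :: "'n spacetime \<Rightarrow> 'n spacetime \<Rightarrow> ('n spacetime \<Rightarrow> 'b::real_normed_vector) \<Rightarrow> 'b" where
  "deriv_along p h f = frechet_derivative f (at p within slab T) h"

abbreviation "axis_dir j \<equiv> (0, axis j 1) :: 'n spacetime"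

definition transport_dir :: "'n spacetime \<Rightarrow> 'n spacetime" where
  "transport_dir p = (1, \<chi> j. v j p)"

definition grad_v :: "'n spacetime \<Rightarrow> 'n \<Rightarrow> 'n \<Rightarrow> real" where
  "grad_v p i k = dx T i (v k) p"

definition grad_d :: "'n spacetime \<Rightarrow> 'm \<Rightarrow> 'n \<Rightarrow> real" where
  "grad_d p \<alpha> i = dx T i (d \<alpha>) p"

lemma dt_dx_deriv_along: "dt T f p = deriv_along p (1, 0) f" "dx T i f p = deriv_along p (axis_dir i) f"
  by (simp_all add: dt_def dx_def dir_deriv_def deriv_along_def)

lemma deriv_along_eq:
  "p \<in> slab T \<Longrightarrow> (f has_derivative f') (at p within slab T) \<Longrightarrow> deriv_along p h f = f' h"
  by (simp add: deriv_along_def frechet_derivative_slab[OF T])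

lemma has_deriv_along:
  "C1_on (slab T) f \<Longrightarrow> p \<in> slab T \<Longrightarrow> (f has_derivative (\<lambda>h. deriv_along p h f)) (at p within slab T)"
  unfolding deriv_along_def by (rule C1_on_has_derivative)

lemma deriv_along_transport:
  assumes "C1_on (slab T) f" "p \<in> slab T"
  shows "deriv_along p (transport_dir p) f = deriv_along p (1, 0) f + (\<Sum>j\<in>UNIV. v j p *\<^sub>R deriv_along p (axis_dir j) f)"
proof -
  have lin: "linear (\<lambda>h. deriv_along p h f)"
    by (rule has_derivative_linear[OF has_deriv_along[OF assms]])
  have "transport_dir p = (1, 0) + (\<Sum>j\<in>UNIV. v j p *\<^sub>R axis_dir j)"
    by (auto simp: transport_dir_def prod_eq_iff fst_sum snd_sum Finite_Cartesian_Product.vec_eq_iff axis_def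
        if_distrib[of "(*) _"] cong: if_cong)
  then show ?thesis
    by (simp only: linear_add[OF lin] linear_sum[OF lin] linear_scale[OF lin])
qed

lemma C1_fields: "C1_on (slab T) \<tau>" "C1_on (slab T) (d \<alpha>)" "C1_on (slab T) (v i)"
    "(A, I) \<in> idx \<Longrightarrow> C1_on (slab T) (m A I)"
  using sol unfolding smooth_solution_N_def smooth_bounded_on_def
  by (auto intro: smooth_on_imp_C1_on)

lemma C1_component: "C1_on (slab T) (\<lambda>p. \<mu> p $ (A, I))"
proof (cases "card A = card I")
  case True
  then have "C1_on (slab T) (mext \<tau> m A I)"
    by (cases "A = {}") (auto simp: mext_def[abs_def] idx_iff C1_fields)
  with True show ?thesis by (simp add: fock_field_nth)
qed (simp add: fock_field_nth C1_on_const)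

lemma \<mu>_has_derivative:
  assumes "p \<in> slab T"
  shows "(\<mu> has_derivative (\<lambda>h. \<chi> q. deriv_along p h (\<lambda>p. \<mu> p $ q))) (at p within slab T)"
proof (rule has_derivative_vec_nth_components)
  fix q :: "'m set \<times> 'n set"
  obtain A I where "q = (A, I)" by fastforce
  then show "((\<lambda>p. \<mu> p $ q) has_derivative (\<lambda>h. (\<chi> q. deriv_along p h (\<lambda>p. \<mu> p $ q)) $ q)) (at p within slab T)"
    using has_deriv_along[OF C1_component[of A I] assms] by simp
qed

lemma deriv_along_\<mu>_nth:
  "p \<in> slab T \<Longrightarrow> deriv_along p h \<mu> $ (A, I) = deriv_along p h (\<lambda>p. \<mu> p $ (A, I))"
  by (simp add: deriv_along_eq[OF _ \<mu>_has_derivative])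

lemma C1_\<mu>: "C1_on (slab T) \<mu>"
proof -
  have eq: "\<mu> p = (\<Sum>q\<in>UNIV. \<mu> p $ q *\<^sub>R axis q 1)" for p
    by (auto simp: Finite_Cartesian_Product.vec_eq_iff axis_def if_distrib[of "(*) _"] cong: if_cong)
  have "C1_on (slab T) (\<lambda>p. \<mu> p $ q)" for q
    using C1_component by (cases q) auto
  then have "C1_on (slab T) (\<lambda>p. \<Sum>q\<in>UNIV. \<mu> p $ q *\<^sub>R axis q 1)"
    by (intro C1_on_intros)
  moreover have "(\<lambda>p. \<Sum>q\<in>UNIV. \<mu> p $ q *\<^sub>R axis q 1) = \<mu>"
    by (rule ext) (rule eq[symmetric])
  ultimately show ?thesis by (rule back_subst[where P = "C1_on (slab T)"])
qed

lemmas C1_all = C1_fields(1-3) C1_\<mu> C1_component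

lemma deriv_along_\<mu>_entries:
  assumes p: "p \<in> slab T"
  shows "deriv_along p h \<mu> $ ({}, {}) = deriv_along p h \<tau>"
    "(A, I) \<in> idx \<Longrightarrow> deriv_along p h \<mu> $ (A, I) = deriv_along p h (m A I)"
    "card A \<noteq> card I \<Longrightarrow> deriv_along p h \<mu> $ (A, I) = 0"
  by (auto simp: deriv_along_\<mu>_nth[OF p] fock_field_nth mext_def idx_iff
      deriv_along_eq[OF p has_derivative_const])

lemma system_at:
  assumes p: "p \<in> slab T"
  shows "tau_eq T \<tau> v p" "d_eq T \<tau> d v m \<alpha> p" "v_eq T \<tau> v m i p"
    "(A, I) \<in> idx \<Longrightarrow> m_eq T \<tau> d v m A I p"
  using sol p unfolding smooth_solution_N_def system_N_def by auto

lemma card_replace: "i \<in> I \<Longrightarrow> k \<notin> I - {i} \<Longrightarrow> card (insert k (I - {i})) = card I"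
  for I :: "'n set"
  by (simp add: card.remove del: card_Diff_singleton card_Diff_insert)

lemma \<mu>_replace:
  assumes "(A, I) \<in> idx" "i \<in> I" "k \<notin> I - {i}"
  shows "\<mu> p $ (A, insert k (I - {i})) = m A (insert k (I - {i})) p"
proof -
  have "card A = card (insert k (I - {i}))"
    using assms by (simp only: idx_iff card_replace not_False_eq_True)
  then show ?thesis
    using assms(1) by (simp only: fock_field_nth refl if_True) (simp add: mext_def idx_iff)
qed

text \<open>
  The equations for \<open>\<tau>\<close> and for all \<open>m\<^bsub>A,I\<^esub>\<close> in one: the entry at \<open>(\<emptyset>, \<emptyset>)\<close> is the equation for \<open>\<tau>\<close>,
  since creators vanish there. At an unbalanced pair all terms are zero, because \<open>shear\<close> and \<open>source\<close>
  preserve the difference of the two cardinalities.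
\<close>

lemma \<mu>_transport:
  assumes p: "p \<in> slab T"
  shows "deriv_along p (transport_dir p) \<mu> = (\<Sum>i\<in>UNIV. grad_v p i i) *\<^sub>R \<mu> p - shear (grad_v p) (\<mu> p) - source (grad_d p) (\<mu> p)"
  unfolding fock_eq_iff
proof (intro allI)
  fix A :: "'m set" and I :: "'n set"
  show "deriv_along p (transport_dir p) \<mu> $ (A, I) =
     ((\<Sum>i\<in>UNIV. grad_v p i i) *\<^sub>R \<mu> p - shear (grad_v p) (\<mu> p) - source (grad_d p) (\<mu> p)) $ (A, I)"
  proof (cases "card A = card I")
    case False
    have "card A \<noteq> card (insert k (I - {i}))" if "i \<in> I" "k \<notin> I - {i}" for i k
      using that False by (simp only: card_replace not_False_eq_True)
    moreover have "card (A - {\<alpha>}) \<noteq> card (I - {i})" if "\<alpha> \<in> A" "i \<in> I" for \<alpha> i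
      using that False by (metis card_Suc_Diff1 finite)
    ultimately have "shear (grad_v p) (\<mu> p) $ (A, I) = 0" "source (grad_d p) (\<mu> p) $ (A, I) = 0"
      by (auto simp: shear_nth source_nth fock_field_nth intro!: sum.neutral)
    with False show ?thesis by (simp add: deriv_along_\<mu>_entries(3)[OF p] fock_field_nth)
  next
    case card: True
    show ?thesis
    proof (cases "A = {}")
      case True
      with card have "I = {}" by auto
      with True system_at(1)[OF p] show ?thesis
        by (simp add: tau_eq_def shear_nth source_nth deriv_along_\<mu>_entries(1)[OF p] fock_field_nth mext_def
            deriv_along_transport[OF C1_fields(1) p] dt_dx_deriv_along grad_v_def mult.commute)
    next
      case False
      with card have idx: "(A, I) \<in> idx" by (simp add: idx_iff)
      have "shear (grad_v p) (\<mu> p) $ (A, I) = (\<Sum>i\<in>I. \<Sum>j | j \<notin> I - {i}.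
          (-1) ^ (rank_in (I - {i}) j + rank_in I i) * m A ((I - {i}) \<union> {j}) p * dx T i (v j) p)"
        unfolding shear_nth
      proof (intro sum.cong refl)
        fix i j assume "i \<in> I" "j \<in> {k. k \<notin> I - {i}}"
        then show "grad_v p i j * (pos_sign I i * (pos_sign (I - {i}) j * \<mu> p $ (A, insert j (I - {i}))))
          = (-1) ^ (rank_in (I - {i}) j + rank_in I i) * m A ((I - {i}) \<union> {j}) p * dx T i (v j) p"
          using \<mu>_replace[OF idx, of i j p] by (simp add: minus_one_power_rank_in grad_v_def)
      qed
      moreover have "source (grad_d p) (\<mu> p) $ (A, I) = (\<Sum>\<alpha>\<in>A. \<Sum>i\<in>I.
          (-1) ^ (rank_in A \<alpha> + rank_in I i) * mext \<tau> m (A - {\<alpha>}) (I - {i}) p * dx T i (d \<alpha>) p)"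
        unfolding source_nth
      proof (intro sum.cong refl)
        fix \<alpha> i assume "\<alpha> \<in> A" "i \<in> I"
        then have "card (A - {\<alpha>}) = card (I - {i})" using card by simp
        then show "grad_d p \<alpha> i * (pos_sign A \<alpha> * (pos_sign I i * \<mu> p $ (A - {\<alpha>}, I - {i})))
          = (-1) ^ (rank_in A \<alpha> + rank_in I i) * mext \<tau> m (A - {\<alpha>}) (I - {i}) p * dx T i (d \<alpha>) p"
          by (simp add: minus_one_power_rank_in fock_field_nth grad_d_def)
      qed
      ultimately show ?thesis
        using system_at(4)[OF p idx] False card
        by (simp add: m_eq_def deriv_along_\<mu>_entries(2)[OF p idx] fock_field_nth mext_def
            deriv_along_transport[OF C1_fields(4)[OF idx] p] dt_dx_deriv_along grad_v_def mult.commute)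
    qed
  qed
qed

lemma inner_deriv_\<mu>:
  assumes p: "p \<in> slab T"
  shows "x \<bullet> deriv_along p h \<mu> = x $ ({}, {}) * deriv_along p h \<tau> + (\<Sum>(A, I)\<in>idx. x $ (A, I) * deriv_along p h (m A I))"
  by (subst inner_balanced) (auto simp: deriv_along_\<mu>_entries[OF p] intro!: sum.cong)

lemma sum_over_columns:
  fixes f :: "'n \<Rightarrow> 'm set \<times> 'n set \<Rightarrow> real"
  assumes "\<And>j A I. (A, I) \<in> idx \<Longrightarrow> \<not> Q j A I \<Longrightarrow> f j (A, I) = 0"
  shows "(\<Sum>j\<in>UNIV. \<Sum>(A, I)\<in>idx. f j (A, I)) = (\<Sum>(A, I)\<in>idx. \<Sum>j | Q j A I. f j (A, I))"
proof -
  have "(\<Sum>j\<in>UNIV. \<Sum>(A, I)\<in>idx. f j (A, I)) = (\<Sum>(A, I)\<in>idx. \<Sum>j\<in>UNIV. f j (A, I))"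
    by (subst sum.swap) (simp add: case_prod_beta)
  also have "\<dots> = (\<Sum>(A, I)\<in>idx. \<Sum>j | Q j A I. f j (A, I))"
    by (intro sum.cong refl) (auto intro!: sum.mono_neutral_right assms)
  finally show ?thesis .
qed

text \<open>
  The terms \<open>\<tau> \<partial>\<^sub>i \<tau>\<close> and \<open>m\<^bsub>A,I\<^esub> \<partial>\<^sub>i m\<^bsub>A,I\<^esub>\<close> of the equation for \<open>v\<^sub>i\<close> form the inner product \<open>\<langle>\<mu>, \<partial>\<^sub>i \<mu>\<rangle>\<close>.
\<close>

lemma v_transport:
  assumes p: "p \<in> slab T"
  shows "deriv_along p (transport_dir p) (v i) = \<mu> p \<bullet> deriv_along p (axis_dir i) \<mu>
     - (\<Sum>j\<in>UNIV. cre_col j (ann_col i (\<mu> p)) \<bullet> deriv_along p (axis_dir j) \<mu>)"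
proof -
  have "(\<Sum>j\<in>UNIV. cre_col j (ann_col i (\<mu> p)) \<bullet> deriv_along p (axis_dir j) \<mu>)
      = (\<Sum>j\<in>UNIV. \<Sum>(A, I)\<in>idx. cre_col j (ann_col i (\<mu> p)) $ (A, I) * dx T j (m A I) p)"
    by (simp add: inner_deriv_\<mu>[OF p] fock_nth dt_dx_deriv_along)
  also have "\<dots> = (\<Sum>(A, I)\<in>idx. \<Sum>j | j \<in> I \<and> i \<notin> I - {j}.
      cre_col j (ann_col i (\<mu> p)) $ (A, I) * dx T j (m A I) p)"
    using sum_over_columns[of "\<lambda>j A I. j \<in> I \<and> i \<notin> I - {j}"
        "\<lambda>j (A, I). cre_col j (ann_col i (\<mu> p)) $ (A, I) * dx T j (m A I) p"]
    by (auto simp: fock_nth)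
  also have "\<dots> = (\<Sum>(A, I)\<in>idx. \<Sum>j | j \<in> I \<and> i \<notin> I - {j}.
          (-1) ^ (rank_in I j + rank_in (I - {j}) i)
          * m A ((I - {j}) \<union> {i}) p * dx T j (m A I) p)"
  proof -
    have key: "cre_col j (ann_col i (\<mu> p)) $ (A, I) * dx T j (m A I) p
        = (-1) ^ (rank_in I j + rank_in (I - {j}) i) * m A ((I - {j}) \<union> {i}) p * dx T j (m A I) p"
      if "(A, I) \<in> idx" "j \<in> I" "i \<notin> I - {j}" for A I j
    proof -
      have "\<mu> p $ (A, insert i (I - {j})) = m A (insert i (I - {j})) p"
        using that by (rule \<mu>_replace)
      moreover have "cre_col j (ann_col i (\<mu> p)) $ (A, I)
          = pos_sign I j * (pos_sign (I - {j}) i * \<mu> p $ (A, insert i (I - {j})))"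
        using that by (simp only: fock_nth if_True if_False)
      ultimately show ?thesis by (simp add: minus_one_power_rank_in)
    qed
    show ?thesis
    proof (intro sum.cong refl)
      fix q :: "'m set \<times> 'n set" assume "q \<in> idx"
      then obtain A I where q: "q = (A, I)" "(A, I) \<in> idx" by (cases q) auto
      show "(case q of (A, I) \<Rightarrow> \<Sum>j | j \<in> I \<and> i \<notin> I - {j}. cre_col j (ann_col i (\<mu> p)) $ (A, I) * dx T j (m A I) p)
        = (case q of (A, I) \<Rightarrow> \<Sum>j | j \<in> I \<and> i \<notin> I - {j}. (-1) ^ (rank_in I j + rank_in (I - {j}) i)
          * m A ((I - {j}) \<union> {i}) p * dx T j (m A I) p)"
        unfolding q(1) prod.case by (intro sum.cong refl key q(2)) blast+
    qed
  qed
  moreover have "\<mu> p \<bullet> deriv_along p (axis_dir i) \<mu> = \<tau> p * dx T i \<tau> p + (\<Sum>(A, I)\<in>idx. m A I p * dx T i (m A I) p)"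
    by (auto simp: inner_deriv_\<mu>[OF p] fock_field_nth mext_def dt_dx_deriv_along idx_iff intro!: sum.cong)
  ultimately show ?thesis
    using system_at(3)[OF p, of i]
    by (simp add: v_eq_def deriv_along_transport[OF C1_fields(3) p] dt_dx_deriv_along)
qed

lemma d_transport:
  assumes p: "p \<in> slab T"
  shows "deriv_along p (transport_dir p) (d \<alpha>) =
     - (\<Sum>j\<in>UNIV. cre_row \<alpha> (cre_col j (\<mu> p)) \<bullet> deriv_along p (axis_dir j) \<mu>)"
proof -
  have "(\<Sum>j\<in>UNIV. cre_row \<alpha> (cre_col j (\<mu> p)) \<bullet> deriv_along p (axis_dir j) \<mu>)
      = (\<Sum>j\<in>UNIV. \<Sum>(A, I)\<in>idx. cre_row \<alpha> (cre_col j (\<mu> p)) $ (A, I) * dx T j (m A I) p)"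
    by (simp add: inner_deriv_\<mu>[OF p] fock_nth dt_dx_deriv_along)
  also have "\<dots> = (\<Sum>(A, I)\<in>idx. \<Sum>j | \<alpha> \<in> A \<and> j \<in> I.
      cre_row \<alpha> (cre_col j (\<mu> p)) $ (A, I) * dx T j (m A I) p)"
    using sum_over_columns[of "\<lambda>j A I. \<alpha> \<in> A \<and> j \<in> I"
        "\<lambda>j (A, I). cre_row \<alpha> (cre_col j (\<mu> p)) $ (A, I) * dx T j (m A I) p"]
    by (auto simp: fock_nth)
  also have "\<dots> = (\<Sum>(A, I) | (A, I) \<in> idx \<and> \<alpha> \<in> A. \<Sum>i\<in>I.
          (-1) ^ (rank_in A \<alpha> + rank_in I i)
          * mext \<tau> m (A - {\<alpha>}) (I - {i}) p * dx T i (m A I) p)"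
  proof (rule sum.mono_neutral_cong_right)
    fix q :: "'m set \<times> 'n set" assume "q \<in> {(A, I). (A, I) \<in> idx \<and> \<alpha> \<in> A}"
    then obtain A I where q: "q = (A, I)" "(A, I) \<in> idx" "\<alpha> \<in> A" by auto
    have key: "cre_row \<alpha> (cre_col j (\<mu> p)) $ (A, I) * dx T j (m A I) p
        = (-1) ^ (rank_in A \<alpha> + rank_in I j) * mext \<tau> m (A - {\<alpha>}) (I - {j}) p * dx T j (m A I) p"
      if "j \<in> I" for j
      using that q by (simp add: fock_nth minus_one_power_rank_in fock_field_nth idx_iff)
    show "(case q of (A, I) \<Rightarrow> \<Sum>j | \<alpha> \<in> A \<and> j \<in> I. cre_row \<alpha> (cre_col j (\<mu> p)) $ (A, I) * dx T j (m A I) p)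
      = (case q of (A, I) \<Rightarrow> \<Sum>i\<in>I. (-1) ^ (rank_in A \<alpha> + rank_in I i)
          * mext \<tau> m (A - {\<alpha>}) (I - {i}) p * dx T i (m A I) p)"
      unfolding q(1) prod.case by (rule sum.cong) (use q(3) in simp, erule key)
  qed (auto, rule ccontr, simp)
  finally show ?thesis
    using system_at(2)[OF p, of \<alpha>]
    by (simp add: d_eq_def deriv_along_transport[OF C1_fields(2) p] dt_dx_deriv_along)
qed

lemma uniform_bound:
  obtains B where "0 \<le> B"
    "\<And>p j. p \<in> slab T \<Longrightarrow> \<bar>v j p\<bar> \<le> B"
    "\<And>p i k. p \<in> slab T \<Longrightarrow> \<bar>grad_v p i k\<bar> \<le> B"
    "\<And>p \<alpha> i. p \<in> slab T \<Longrightarrow> \<bar>grad_d p \<alpha> i\<bar> \<le> B"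
    "\<And>p. p \<in> slab T \<Longrightarrow> norm (\<mu> p) \<le> B"
    "\<And>p j. p \<in> slab T \<Longrightarrow> norm (deriv_along p (axis_dir j) \<mu>) \<le> B"
proof -
  have axis: "axis_dir j \<in> Basis" for j :: 'n
    by (auto simp: Basis_prod_def axis_in_Basis_iff)
  have sb: "smooth_bounded_on (slab T) f \<Longrightarrow> bounded (f ` slab T) \<and> (\<forall>j. bounded (dx T j f ` slab T))"
    for f :: "'n field"
    using axis by (auto simp: smooth_bounded_on_def dx_def)
  have fields: "smooth_bounded_on (slab T) \<tau>" "smooth_bounded_on (slab T) (d \<alpha>)"
    "smooth_bounded_on (slab T) (v i)" "(A, I) \<in> idx \<Longrightarrow> smooth_bounded_on (slab T) (m A I)" for \<alpha> i A I
    using sol unfolding smooth_solution_N_def by auto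
  have comp: "bounded ((\<lambda>p. \<mu> p $ q) ` slab T)" "bounded ((\<lambda>p. deriv_along p (axis_dir j) \<mu> $ q) ` slab T)" for q j
  proof -
    obtain A I where q: "q = (A, I)" by fastforce
    consider "card A \<noteq> card I" | "A = {}" "I = {}" | "(A, I) \<in> idx"
      by (cases "card A = card I"; cases "A = {}") (auto simp: idx_iff)
    then have "bounded ((\<lambda>p. \<mu> p $ q) ` slab T) \<and> bounded ((\<lambda>p. deriv_along p (axis_dir j) \<mu> $ q) ` slab T)"
    proof cases
      case 1
      then show ?thesis
        by (auto simp: q fock_field_nth deriv_along_\<mu>_entries(3) intro!: boundedI[of _ 0])
    next
      case 2
      then have "(\<lambda>p. \<mu> p $ q) ` slab T = \<tau> ` slab T"
        "(\<lambda>p. deriv_along p (axis_dir j) \<mu> $ q) ` slab T = dx T j \<tau> ` slab T"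
        by (auto simp: q fock_field_nth mext_def deriv_along_\<mu>_entries(1) dt_dx_deriv_along intro!: image_cong)
      with sb[OF fields(1)] show ?thesis by simp
    next
      case 3
      then have "(\<lambda>p. \<mu> p $ q) ` slab T = m A I ` slab T"
        "(\<lambda>p. deriv_along p (axis_dir j) \<mu> $ q) ` slab T = dx T j (m A I) ` slab T"
        by (auto simp: q fock_field_nth mext_def deriv_along_\<mu>_entries(2) dt_dx_deriv_along idx_iff intro!: image_cong)
      with sb[OF fields(4)[OF 3]] show ?thesis by simp
    qed
    then show "bounded ((\<lambda>p. \<mu> p $ q) ` slab T)" "bounded ((\<lambda>p. deriv_along p (axis_dir j) \<mu> $ q) ` slab T)" by auto
  qed
  have "bounded ((\<Union>j. v j ` slab T) \<union> (\<Union>i k. (\<lambda>p. grad_v p i k) ` slab T) \<union> (\<Union>\<alpha> i. (\<lambda>p. grad_d p \<alpha> i) ` slab T))"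
    using sb fields(2,3) by (auto simp: grad_v_def grad_d_def intro!: bounded_UN)
  then obtain B1 where B1: "\<forall>y \<in> (\<Union>j. v j ` slab T) \<union> (\<Union>i k. (\<lambda>p. grad_v p i k) ` slab T) \<union> (\<Union>\<alpha> i. (\<lambda>p. grad_d p \<alpha> i) ` slab T). \<bar>y\<bar> \<le> B1"
    by (auto simp: bounded_iff)
  have "bounded ((\<Union>q. (\<lambda>p. \<mu> p $ q) ` slab T) \<union> (\<Union>j q. (\<lambda>p. deriv_along p (axis_dir j) \<mu> $ q) ` slab T))"
    using comp by (auto intro!: bounded_UN)
  then obtain B2 where B2: "\<forall>y \<in> (\<Union>q. (\<lambda>p. \<mu> p $ q) ` slab T) \<union> (\<Union>j q. (\<lambda>p. deriv_along p (axis_dir j) \<mu> $ q) ` slab T). \<bar>y\<bar> \<le> B2"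
    by (auto simp: bounded_iff)
  define N where "N = real CARD('m set \<times> 'n set)"
  have norm_le: "norm x \<le> N * B2" if "\<And>q. \<bar>x $ q\<bar> \<le> B2" for x :: "('m, 'n) fock"
  proof -
    have "norm x \<le> (\<Sum>q\<in>UNIV. \<bar>x $ q\<bar>)" by (rule norm_le_l1_cart)
    also have "\<dots> \<le> (\<Sum>q\<in>(UNIV :: ('m set \<times> 'n set) set). B2)" by (intro sum_mono that)
    finally show ?thesis by (simp add: N_def)
  qed
  show ?thesis
  proof (rule that[of "max 0 (max B1 (N * B2))"])
    fix p :: "'n spacetime" assume p: "p \<in> slab T"
    have "\<bar>\<mu> p $ q\<bar> \<le> B2" "\<bar>deriv_along p (axis_dir j) \<mu> $ q\<bar> \<le> B2" for q j using B2 p by blast+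
    then have "norm (\<mu> p) \<le> N * B2" "norm (deriv_along p (axis_dir j) \<mu>) \<le> N * B2" for j by (intro norm_le; simp)+
    then show "norm (\<mu> p) \<le> max 0 (max B1 (N * B2))"
      "norm (deriv_along p (axis_dir j) \<mu>) \<le> max 0 (max B1 (N * B2))" for j
      by (simp_all add: le_max_iff_disj)
    have "\<bar>v j p\<bar> \<le> B1" "\<bar>grad_v p i k\<bar> \<le> B1" "\<bar>grad_d p \<alpha> i\<bar> \<le> B1" for j i k \<alpha>
      using B1 p by (simp_all add: ball_Un)
    then show "\<bar>v j p\<bar> \<le> max 0 (max B1 (N * B2))" "\<bar>grad_v p i k\<bar> \<le> max 0 (max B1 (N * B2))"
      "\<bar>grad_d p \<alpha> i\<bar> \<le> max 0 (max B1 (N * B2))" for j i k \<alpha>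
      by (simp_all add: le_max_iff_disj)
  qed simp
qed

section \<open>The constraints as vanishing defects\<close>

definition minor_field :: "'n spacetime \<Rightarrow> 'm \<Rightarrow> 'n \<Rightarrow> real" where
  "minor_field p \<alpha> i = m {\<alpha>} {i} p / \<tau> p"

text \<open>
  These are \<open>E\<^sub>j\<close>, \<open>\<lambda>\<close> and \<open>z\<close> of the introduction. Multiplying the expansion
  \<open>c\<^sub>j \<mu> = F\<^bsub>\<alpha>j\<^esub> r\<^sub>\<alpha>\<^sup>* \<mu>\<close> by \<open>\<tau>\<close> removes the quotient, which need not be bounded.
\<close>

definition minor_defect :: "'n \<Rightarrow> 'n spacetime \<Rightarrow> ('m, 'n) fock" where
  "minor_defect j p = \<tau> p *\<^sub>R ann_col j (\<mu> p) - (\<Sum>\<alpha>\<in>UNIV. \<mu> p $ ({\<alpha>}, {j}) *\<^sub>R cre_row \<alpha> (\<mu> p))"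

definition energy_defect :: "'n spacetime \<Rightarrow> real" where
  "energy_defect p = ((\<Sum>\<alpha>\<in>UNIV. d \<alpha> p * d \<alpha> p) + (\<Sum>i\<in>UNIV. v i p * v i p) + \<mu> p \<bullet> \<mu> p - 1) / 2"

definition momentum_defect :: "'n spacetime \<Rightarrow> ('m, 'n) fock" where
  "momentum_defect p = (\<Sum>i\<in>UNIV. v i p *\<^sub>R cre_col i (\<mu> p)) - (\<Sum>\<alpha>\<in>UNIV. d \<alpha> p *\<^sub>R ann_row \<alpha> (\<mu> p))"

lemma \<mu>_entry: "\<mu> p $ ({\<alpha>}, {i}) = m {\<alpha>} {i} p" "\<mu> p $ ({}, {}) = \<tau> p"
  by (simp_all add: fock_field_nth mext_def)

text \<open>
  The entry at \<open>(\<emptyset>, \<emptyset>)\<close>, which \<open>idx\<close> leaves out, is \<open>\<tau>\<close> on both sides because the empty minor is 1.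
\<close>

lemma minor_constraint_iff:
  "(\<forall>(A, I)\<in>idx. m A I p = \<tau> p * minor (minor_field p) A I) \<longleftrightarrow> \<mu> p = \<tau> p *\<^sub>R minors (minor_field p)"
proof
  assume constr: "\<forall>(A, I)\<in>idx. m A I p = \<tau> p * minor (minor_field p) A I"
  have "\<mu> p $ (A, I) = \<tau> p * minors (minor_field p) $ (A, I)" for A I
  proof (cases "(A, I) \<in> idx")
    case True
    then show ?thesis using constr by (auto simp: fock_field_nth mext_def minors_nth idx_iff)
  next
    case False
    then show ?thesis
      by (cases "card A = card I") (auto simp: fock_field_nth mext_def minors_nth idx_iff minor_def)
  qed
  then show "\<mu> p = \<tau> p *\<^sub>R minors (minor_field p)" by (simp add: fock_eq_iff)
next
  assume eq: "\<mu> p = \<tau> p *\<^sub>R minors (minor_field p)"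
  show "\<forall>(A, I)\<in>idx. m A I p = \<tau> p * minor (minor_field p) A I"
  proof clarify
    fix A :: "'m set" and I :: "'n set" assume "(A, I) \<in> idx"
    moreover have "\<mu> p $ (A, I) = \<tau> p * minors (minor_field p) $ (A, I)" by (subst eq) simp
    ultimately show "m A I p = \<tau> p * minor (minor_field p) A I"
      by (simp add: fock_field_nth mext_def minors_nth idx_iff)
  qed
qed

lemma minors_imp_expansions:
  assumes "\<mu> p = \<tau> p *\<^sub>R minors (minor_field p)"
  shows "ann_col j (\<mu> p) = (\<Sum>\<alpha>\<in>UNIV. minor_field p \<alpha> j *\<^sub>R cre_row \<alpha> (\<mu> p))"
    "ann_row \<alpha> (\<mu> p) = (\<Sum>i\<in>UNIV. minor_field p \<alpha> i *\<^sub>R cre_col i (\<mu> p))"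
  unfolding assms by (simp_all add: fock_linear_simps ann_col_minors ann_row_minors scaleR_sum_right mult.commute)

lemma minor_defect_zero_iff:
  assumes \<tau>: "\<tau> p \<noteq> 0"
  shows "(\<forall>j. minor_defect j p = 0) \<longleftrightarrow> \<mu> p = \<tau> p *\<^sub>R minors (minor_field p)"
proof -
  have entry: "\<mu> p $ ({\<alpha>}, {j}) = \<tau> p * minor_field p \<alpha> j" for \<alpha> j
    using \<tau> by (simp add: \<mu>_entry minor_field_def)
  have defect: "minor_defect j p = \<tau> p *\<^sub>R (ann_col j (\<mu> p) - (\<Sum>\<alpha>\<in>UNIV. minor_field p \<alpha> j *\<^sub>R cre_row \<alpha> (\<mu> p)))" for j
    by (simp add: minor_defect_def entry scaleR_diff_right scaleR_sum_right)
  show ?thesis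
  proof
    assume "\<forall>j. minor_defect j p = 0"
    then have "ann_col j (\<mu> p) = (\<Sum>\<alpha>\<in>UNIV. minor_field p \<alpha> j *\<^sub>R cre_row \<alpha> (\<mu> p))" for j
      using \<tau> by (simp add: defect)
    from minors_unique[OF this] have "card A = card I \<Longrightarrow> \<mu> p $ (A, I) = \<tau> p * minor (minor_field p) A I" for A I
      by (simp add: \<mu>_entry)
    moreover have "card A \<noteq> card I \<Longrightarrow> \<mu> p $ (A, I) = 0" for A I
      by (simp add: fock_field_nth)
    ultimately show "\<mu> p = \<tau> p *\<^sub>R minors (minor_field p)"
      by (simp add: fock_eq_iff minors_nth)
  next
    assume "\<mu> p = \<tau> p *\<^sub>R minors (minor_field p)"
    note expansion = minors_imp_expansions(1)[OF this]
    show "\<forall>j. minor_defect j p = 0"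
      unfolding defect by (subst expansion) simp
  qed
qed

text \<open>
  The entries of \<open>z\<close> at \<open>(\<emptyset>, {i})\<close> are the momentum constraints. Conversely, expanding along rows
  gives \<open>z = (v\<^sub>i - F\<^bsub>\<alpha>i\<^esub> d\<^sub>\<alpha>) c\<^sub>i\<^sup>* \<mu>\<close>, whose coefficients are the constraints divided by \<open>\<tau>\<close>.
\<close>

lemma momentum_defect_zero_iff:
  assumes minors: "\<mu> p = \<tau> p *\<^sub>R minors (minor_field p)" and \<tau>: "\<tau> p \<noteq> 0"
  shows "momentum_defect p = 0 \<longleftrightarrow> (\<forall>i. \<tau> p * v i p = (\<Sum>\<alpha>\<in>UNIV. m {\<alpha>} {i} p * d \<alpha> p))"
proof
  assume "momentum_defect p = 0"
  then have "momentum_defect p $ ({}, {i}) = 0" for i by simp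
  moreover have "momentum_defect p $ ({}, {i}) = v i p * \<tau> p - (\<Sum>\<alpha>\<in>UNIV. d \<alpha> p * m {\<alpha>} {i} p)" for i
    unfolding momentum_defect_def vector_minus_component sum_cre_col_nth
    by (simp add: fock_nth \<mu>_entry)
  ultimately show "\<forall>i. \<tau> p * v i p = (\<Sum>\<alpha>\<in>UNIV. m {\<alpha>} {i} p * d \<alpha> p)"
    by (simp add: mult.commute)
next
  assume v: "\<forall>i. \<tau> p * v i p = (\<Sum>\<alpha>\<in>UNIV. m {\<alpha>} {i} p * d \<alpha> p)"
  have "v i p = (\<Sum>\<alpha>\<in>UNIV. d \<alpha> p * minor_field p \<alpha> i)" for i
  proof -
    have "v i p = (\<Sum>\<alpha>\<in>UNIV. m {\<alpha>} {i} p * d \<alpha> p) / \<tau> p" using v[rule_format, of i] \<tau> by (simp add: field_simps)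
    then show ?thesis by (simp add: minor_field_def sum_divide_distrib mult.commute)
  qed
  then have "(\<Sum>i\<in>UNIV. v i p *\<^sub>R cre_col i (\<mu> p)) = (\<Sum>\<alpha>\<in>UNIV. d \<alpha> p *\<^sub>R ann_row \<alpha> (\<mu> p))"
    unfolding minors_imp_expansions(2)[OF minors] scaleR_sum_right scaleR_scaleR
    by (simp add: scaleR_sum_left) (rule sum.swap)
  then show "momentum_defect p = 0" by (simp add: momentum_defect_def)
qed

lemma energy_defect_zero_iff:
  "energy_defect p = 0 \<longleftrightarrow> 1 = (\<Sum>\<alpha>\<in>UNIV. (d \<alpha> p)\<^sup>2) + (\<Sum>i\<in>UNIV. (v i p)\<^sup>2) + (\<tau> p)\<^sup>2
            + (\<Sum>(A, I)\<in>idx. (m A I p)\<^sup>2)"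
proof -
  have "\<mu> p \<bullet> \<mu> p = (\<tau> p)\<^sup>2 + (\<Sum>(A, I)\<in>idx. (m A I p)\<^sup>2)"
    by (subst inner_balanced) (auto simp: fock_field_nth mext_def idx_iff power2_eq_square intro!: sum.cong)
  then show ?thesis by (auto simp: energy_defect_def power2_eq_square)
qed

lemma constraints_iff_defects:
  assumes "\<tau> p \<noteq> 0"
  shows "constraints \<tau> d v m p \<longleftrightarrow>
    (\<forall>j. minor_defect j p = 0) \<and> energy_defect p = 0 \<and> momentum_defect p = 0"
  unfolding constraints_def Let_def minor_field_def[abs_def, symmetric]
  using minor_constraint_iff[of p] minor_defect_zero_iff[OF assms] momentum_defect_zero_iff[OF _ assms]
    energy_defect_zero_iff[of p]
  by (auto simp: minor_field_def[abs_def])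


section \<open>Propagation of the constraints\<close>

lemma C1_defects:
  "C1_on (slab T) (minor_defect j)" "C1_on (slab T) energy_defect" "C1_on (slab T) momentum_defect"
proof -
  have "C1_on (slab T) (\<lambda>p. ((\<Sum>\<alpha>\<in>UNIV. d \<alpha> p * d \<alpha> p) + (\<Sum>i\<in>UNIV. v i p * v i p) + \<mu> p \<bullet> \<mu> p - 1) * (1 / 2))"
    by (intro C1_on_intros C1_all)
  then show "C1_on (slab T) energy_defect" by (simp add: energy_defect_def[abs_def])
qed (unfold minor_defect_def[abs_def] momentum_defect_def[abs_def], (intro C1_on_intros C1_all)+)

lemmas fock_has_derivative = bounded_linear_fock[THEN bounded_linear.has_derivative]

lemma deriv_along_minor_defect:
  assumes p: "p \<in> slab T"
  shows "deriv_along p h (minor_defect j) =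
    deriv_along p h \<tau> *\<^sub>R ann_col j (\<mu> p) + \<tau> p *\<^sub>R ann_col j (deriv_along p h \<mu>)
    - (\<Sum>\<alpha>\<in>UNIV. deriv_along p h (\<lambda>p. \<mu> p $ ({\<alpha>}, {j})) *\<^sub>R cre_row \<alpha> (\<mu> p)
         + \<mu> p $ ({\<alpha>}, {j}) *\<^sub>R cre_row \<alpha> (deriv_along p h \<mu>))"
proof -
  have "(minor_defect j has_derivative (\<lambda>h.
      (\<tau> p *\<^sub>R ann_col j (deriv_along p h \<mu>) + deriv_along p h \<tau> *\<^sub>R ann_col j (\<mu> p))
      - (\<Sum>\<alpha>\<in>UNIV. \<mu> p $ ({\<alpha>}, {j}) *\<^sub>R cre_row \<alpha> (deriv_along p h \<mu>)
           + deriv_along p h (\<lambda>p. \<mu> p $ ({\<alpha>}, {j})) *\<^sub>R cre_row \<alpha> (\<mu> p)))) (at p within slab T)"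
    unfolding minor_defect_def[abs_def]
    by (intro has_derivative_diff has_derivative_sum has_derivative_scaleR fock_has_derivative has_deriv_along C1_all p)
  from deriv_along_eq[OF p this] show ?thesis by (simp add: add.commute)
qed

lemma deriv_along_momentum_defect:
  assumes p: "p \<in> slab T"
  shows "deriv_along p h momentum_defect =
    (\<Sum>i\<in>UNIV. deriv_along p h (v i) *\<^sub>R cre_col i (\<mu> p) + v i p *\<^sub>R cre_col i (deriv_along p h \<mu>))
    - (\<Sum>\<alpha>\<in>UNIV. deriv_along p h (d \<alpha>) *\<^sub>R ann_row \<alpha> (\<mu> p) + d \<alpha> p *\<^sub>R ann_row \<alpha> (deriv_along p h \<mu>))"
proof -
  have "(momentum_defect has_derivative (\<lambda>h.
      (\<Sum>i\<in>UNIV. v i p *\<^sub>R cre_col i (deriv_along p h \<mu>) + deriv_along p h (v i) *\<^sub>R cre_col i (\<mu> p))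
      - (\<Sum>\<alpha>\<in>UNIV. d \<alpha> p *\<^sub>R ann_row \<alpha> (deriv_along p h \<mu>) + deriv_along p h (d \<alpha>) *\<^sub>R ann_row \<alpha> (\<mu> p)))) (at p within slab T)"
    unfolding momentum_defect_def[abs_def]
    by (intro has_derivative_diff has_derivative_sum has_derivative_scaleR fock_has_derivative has_deriv_along C1_all p)
  from deriv_along_eq[OF p this] show ?thesis by (simp add: add.commute)
qed

lemma deriv_along_energy_defect:
  assumes p: "p \<in> slab T"
  shows "deriv_along p h energy_defect =
    (\<Sum>\<alpha>\<in>UNIV. d \<alpha> p * deriv_along p h (d \<alpha>)) + (\<Sum>i\<in>UNIV. v i p * deriv_along p h (v i)) + \<mu> p \<bullet> deriv_along p h \<mu>"
proof -
  have "(energy_defect has_derivative (\<lambda>h.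
      ((\<Sum>\<alpha>\<in>UNIV. d \<alpha> p * deriv_along p h (d \<alpha>) + deriv_along p h (d \<alpha>) * d \<alpha> p)
      + (\<Sum>i\<in>UNIV. v i p * deriv_along p h (v i) + deriv_along p h (v i) * v i p)
      + (\<mu> p \<bullet> deriv_along p h \<mu> + deriv_along p h \<mu> \<bullet> \<mu> p) - 0) / 2)) (at p within slab T)"
    unfolding energy_defect_def[abs_def]
    by (intro bounded_linear.has_derivative[OF bounded_linear_divide] has_derivative_diff has_derivative_add has_derivative_sum has_derivative_mult
        has_derivative_inner has_derivative_const has_deriv_along C1_all p)
  from deriv_along_eq[OF p this] show ?thesis
    by (simp add: mult.commute inner_commute add_divide_distrib flip: sum_distrib_left)
qed

text \<open>
  The entries of \<open>\<mu>\<close> that serve as coefficients of the minor defect satisfy the equations that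
  \<open>minor_defect_transport\<close> asks for.
\<close>

lemma entry_transport:
  assumes p: "p \<in> slab T"
  shows "deriv_along p (transport_dir p) \<tau> = (\<Sum>i\<in>UNIV. grad_v p i i) * \<tau> p"
    and "deriv_along p (transport_dir p) (\<lambda>p. \<mu> p $ ({\<alpha>}, {j})) = (\<Sum>i\<in>UNIV. grad_v p i i) * \<mu> p $ ({\<alpha>}, {j})
      - (\<Sum>k\<in>UNIV. grad_v p j k * \<mu> p $ ({\<alpha>}, {k})) - \<tau> p * grad_d p \<alpha> j"
  unfolding deriv_along_\<mu>_entries(1)[OF p, symmetric] deriv_along_\<mu>_nth[OF p, symmetric] \<mu>_transport[OF p]
  by (simp_all add: shear_nth source_nth \<mu>_entry(2))

lemma shear_source_bounds:
  fixes B :: real and P :: "'n \<Rightarrow> 'n \<Rightarrow> real" and S :: "'m \<Rightarrow> 'n \<Rightarrow> real" and x :: "('m, 'n) fock"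
  assumes "\<And>i k. \<bar>P i k\<bar> \<le> B" "\<And>\<alpha> i. \<bar>S \<alpha> i\<bar> \<le> B"
  shows "norm (shear P x) \<le> CARD('n) * (CARD('n) * B) * norm x"
    "norm (source S x) \<le> CARD('m) * (CARD('n) * B) * norm x"
    "\<bar>\<Sum>i\<in>UNIV. P i i\<bar> \<le> CARD('n) * B"
proof -
  have "(\<Sum>i\<in>UNIV. \<Sum>k\<in>UNIV. \<bar>P i k\<bar>) \<le> (\<Sum>i\<in>(UNIV::'n set). \<Sum>k\<in>(UNIV::'n set). B)"
    "(\<Sum>\<alpha>\<in>UNIV. \<Sum>i\<in>UNIV. \<bar>S \<alpha> i\<bar>) \<le> (\<Sum>\<alpha>\<in>(UNIV::'m set). \<Sum>i\<in>(UNIV::'n set). B)"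
    by (intro sum_mono assms)+
  then show "norm (shear P x) \<le> CARD('n) * (CARD('n) * B) * norm x"
    "norm (source S x) \<le> CARD('m) * (CARD('n) * B) * norm x"
    by (auto intro!: order_trans[OF norm_shear_le] order_trans[OF norm_source_le] mult_right_mono)
  have "\<bar>\<Sum>i\<in>UNIV. P i i\<bar> \<le> (\<Sum>i\<in>UNIV. \<bar>P i i\<bar>)" by (rule sum_abs)
  also have "\<dots> \<le> (\<Sum>i\<in>(UNIV::'n set). B)" by (intro sum_mono assms)
  finally show "\<bar>\<Sum>i\<in>UNIV. P i i\<bar> \<le> CARD('n) * B" by simp
qed

text \<open>The density is \<open>\<Sum>\<^sub>j |E\<^sub>j|\<^sup>2\<close>, which is only transported: there is no flux besides that of \<open>v\<close>.\<close>

lemma minor_defect_vanishes: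
  assumes init: "\<And>x j. minor_defect j (0, x) = 0" and p0: "p0 \<in> slab T"
  shows "minor_defect j p0 = 0"
proof -
  obtain B where B: "0 \<le> B"
    "\<And>p j. p \<in> slab T \<Longrightarrow> \<bar>v j p\<bar> \<le> B"
    "\<And>p i k. p \<in> slab T \<Longrightarrow> \<bar>grad_v p i k\<bar> \<le> B"
    "\<And>p \<alpha> i. p \<in> slab T \<Longrightarrow> \<bar>grad_d p \<alpha> i\<bar> \<le> B"
    using uniform_bound by metis
  define u where "u p = (\<Sum>j\<in>UNIV. minor_defect j p \<bullet> minor_defect j p)" for p
  define K where "K = 2 * (CARD('n) * B) + CARD('n) * (CARD('n) * B) + CARD('m) * (CARD('n) * B) + CARD('n) * B"
  have C1_u: "C1_on (slab T) u"
    unfolding u_def[abs_def] by (intro C1_on_intros C1_defects)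
  have u_nonneg: "0 \<le> u p" for p unfolding u_def by (intro sum_nonneg) simp
  have u_deriv: "deriv_along p h u = (\<Sum>j\<in>UNIV. 2 * (minor_defect j p \<bullet> deriv_along p h (minor_defect j)))"
    if p: "p \<in> slab T" for p h
  proof -
    have "(u has_derivative (\<lambda>h. \<Sum>j\<in>UNIV. minor_defect j p \<bullet> deriv_along p h (minor_defect j)
        + deriv_along p h (minor_defect j) \<bullet> minor_defect j p)) (at p within slab T)"
      unfolding u_def[abs_def]
      by (intro has_derivative_sum has_derivative_inner has_deriv_along C1_defects p)
    from deriv_along_eq[OF p this] show ?thesis by (simp add: inner_commute)
  qed
  have growth: "deriv_along p (transport_dir p) u \<le> 2 * (CARD('n) * K) * u p" if p: "p \<in> slab T" for p
  proof -
    let ?w = "\<Sum>i\<in>UNIV. grad_v p i i"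
    note zeroth = shear_source_bounds[of "grad_v p" B "grad_d p", OF B(3)[OF p] B(4)[OF p]]
    have E_le: "norm (minor_defect k p) \<le> sqrt (u p)" for k
      unfolding u_def norm_eq_sqrt_inner
      by (intro real_sqrt_le_mono member_le_sum) auto
    have "minor_defect j p \<bullet> deriv_along p (transport_dir p) (minor_defect j) \<le> K * u p" for j
    proof -
      have eq: "deriv_along p (transport_dir p) (minor_defect j) = (2 * ?w) *\<^sub>R minor_defect j p
          - shear (grad_v p) (minor_defect j p) + source (grad_d p) (minor_defect j p)
          - (\<Sum>k\<in>UNIV. grad_v p j k *\<^sub>R minor_defect k p)"
        unfolding deriv_along_minor_defect[OF p]
        by (rule minor_defect_transport[where E = "\<lambda>j. minor_defect j p"
              and M = "\<lambda>\<alpha> j. \<mu> p $ ({\<alpha>}, {j})", OF \<mu>_transport[OF p] entry_transport[OF p]])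
           (simp add: minor_defect_def)
      have "norm (\<Sum>k\<in>UNIV. grad_v p j k *\<^sub>R minor_defect k p) \<le> (\<Sum>k\<in>(UNIV::'n set). B * sqrt (u p))"
      proof (rule sum_norm_le)
        fix k
        have "\<bar>grad_v p j k\<bar> * norm (minor_defect k p) \<le> B * sqrt (u p)"
          by (intro mult_mono B(3)[OF p] E_le) (use B(1) in auto)
        then show "norm (grad_v p j k *\<^sub>R minor_defect k p) \<le> B * sqrt (u p)" by simp
      qed
      moreover have "norm ((2 * ?w) *\<^sub>R minor_defect j p) \<le> 2 * (CARD('n) * B) * norm (minor_defect j p)"
        using mult_right_mono[OF zeroth(3) norm_ge_zero[of "minor_defect j p"]] by (simp add: abs_mult)
      ultimately have "norm (deriv_along p (transport_dir p) (minor_defect j))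
          \<le> (2 * (CARD('n) * B) + CARD('n) * (CARD('n) * B) + CARD('m) * (CARD('n) * B)) * norm (minor_defect j p)
            + CARD('n) * B * sqrt (u p)"
        unfolding eq
        using zeroth(1,2)[of "minor_defect j p"]
          norm_triangle_ineq4[of "(2 * ?w) *\<^sub>R minor_defect j p - shear (grad_v p) (minor_defect j p)
            + source (grad_d p) (minor_defect j p)" "\<Sum>k\<in>UNIV. grad_v p j k *\<^sub>R minor_defect k p"]
          norm_triangle_ineq[of "(2 * ?w) *\<^sub>R minor_defect j p - shear (grad_v p) (minor_defect j p)"
            "source (grad_d p) (minor_defect j p)"]
          norm_triangle_ineq4[of "(2 * ?w) *\<^sub>R minor_defect j p" "shear (grad_v p) (minor_defect j p)"]
        by (simp add: distrib_right)
      also have "\<dots> \<le> (2 * (CARD('n) * B) + CARD('n) * (CARD('n) * B) + CARD('m) * (CARD('n) * B)) * sqrt (u p)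
            + CARD('n) * B * sqrt (u p)"
        using B(1) by (intro add_mono mult_left_mono E_le) auto
      also have "\<dots> = K * sqrt (u p)" by (simp add: K_def distrib_right)
      finally have D_le: "norm (deriv_along p (transport_dir p) (minor_defect j)) \<le> K * sqrt (u p)" .
      have "minor_defect j p \<bullet> deriv_along p (transport_dir p) (minor_defect j)
          \<le> norm (minor_defect j p) * norm (deriv_along p (transport_dir p) (minor_defect j))"
        by (rule norm_cauchy_schwarz)
      also have "\<dots> \<le> sqrt (u p) * (K * sqrt (u p))"
        using u_nonneg[of p] by (intro mult_mono E_le D_le) auto
      also have "\<dots> = K * u p" using u_nonneg[of p] by (simp add: mult.left_commute)
      finally show ?thesis .
    qed
    then have "deriv_along p (transport_dir p) u \<le> (\<Sum>j\<in>(UNIV::'n set). 2 * (K * u p))"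
      unfolding u_deriv[OF p] by (intro sum_mono) simp
    then show ?thesis by (simp add: mult_ac)
  qed
  have "u p0 = 0"
  proof (rule transport_energy_uniqueness[OF T C1_u _ C1_fields(3), where g = "\<lambda>j p. 0" and B = B
        and C = "2 * (CARD('n) * K)"])
    fix p :: "'n spacetime" assume p: "p \<in> slab T"
    show "dt T u p + (\<Sum>j\<in>UNIV. v j p * dx T j u p)
        \<le> (\<Sum>j\<in>UNIV. dx T j (\<lambda>p. 0) p) + 2 * (CARD('n) * K) * u p"
      using growth[OF p] unfolding dt_dx_deriv_along
      by (simp add: deriv_along_transport[OF C1_u p] deriv_along_eq[OF p has_derivative_const])
  qed (use B u_nonneg init p0 in \<open>auto simp: C1_on_const grad_v_def u_def\<close>)
  then have "minor_defect j p0 \<bullet> minor_defect j p0 = 0"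
    unfolding u_def by (subst (asm) sum_nonneg_eq_0_iff) auto
  then show ?thesis by simp
qed

text \<open>
  In \<open>D e\<close> for \<open>e = \<lambda>\<^sup>2 + |z|\<^sup>2\<close> the first-order terms
  \<open>2 \<lambda> \<langle>c\<^sub>j\<^sup>* \<mu>, \<partial>\<^sub>j z\<rangle> + 2 \<partial>\<^sub>j \<lambda> \<langle>z, c\<^sub>j\<^sup>* \<mu>\<rangle>\<close> are the divergence of the flux \<open>g\<^sub>j = 2 \<lambda> \<langle>z, c\<^sub>j\<^sup>* \<mu>\<rangle>\<close> up to
  \<open>2 \<lambda> \<langle>z, c\<^sub>j\<^sup>* \<partial>\<^sub>j \<mu>\<rangle>\<close>. Since creators are contractions, \<open>|g\<^sub>j| \<le> |\<mu>| e\<close> and the remaining terms are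
  bounded by a multiple of \<open>e\<close>.
\<close>

lemma energy_momentum_defects_vanish:
  assumes \<tau>: "\<And>p. p \<in> slab T \<Longrightarrow> \<tau> p \<noteq> 0"
    and minors: "\<And>p j. p \<in> slab T \<Longrightarrow> minor_defect j p = 0"
    and init: "\<And>x. energy_defect (0, x) = 0" "\<And>x. momentum_defect (0, x) = 0" and p0: "p0 \<in> slab T"
  shows "energy_defect p0 = 0 \<and> momentum_defect p0 = 0"
proof -
  obtain B where B: "0 \<le> B"
    "\<And>p j. p \<in> slab T \<Longrightarrow> \<bar>v j p\<bar> \<le> B"
    "\<And>p i k. p \<in> slab T \<Longrightarrow> \<bar>grad_v p i k\<bar> \<le> B"
    "\<And>p \<alpha> i. p \<in> slab T \<Longrightarrow> \<bar>grad_d p \<alpha> i\<bar> \<le> B"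
    "\<And>p. p \<in> slab T \<Longrightarrow> norm (\<mu> p) \<le> B"
    "\<And>p j. p \<in> slab T \<Longrightarrow> norm (deriv_along p (axis_dir j) \<mu>) \<le> B"
    using uniform_bound by metis
  let ?l = energy_defect and ?z = momentum_defect
  define e where "e p = ?l p * ?l p + ?z p \<bullet> ?z p" for p
  define g where "g j p = 2 * (?l p * (?z p \<bullet> cre_col j (\<mu> p)))" for j p
  define K where "K = CARD('n) * (CARD('n) * B) + CARD('m) * (CARD('n) * B) + CARD('n) * B"
  have C1_e: "C1_on (slab T) e"
    unfolding e_def[abs_def] by (intro C1_on_intros C1_defects)
  have C1_g: "C1_on (slab T) (g j)" for j
    unfolding g_def[abs_def] by (intro C1_on_intros C1_defects C1_all)
  have e_nonneg: "0 \<le> e p" for p unfolding e_def by simp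
  have amgm: "2 * (\<bar>?l p\<bar> * norm (?z p)) \<le> e p" for p
    using sum_squares_bound[of "\<bar>?l p\<bar>" "norm (?z p)"]
    by (simp add: e_def power2_eq_square dot_square_norm mult.assoc)
  have e_deriv: "deriv_along p h e = 2 * (?l p * deriv_along p h ?l) + 2 * (?z p \<bullet> deriv_along p h ?z)"
    if p: "p \<in> slab T" for p h
  proof -
    have "(e has_derivative (\<lambda>h. (?l p * deriv_along p h ?l + deriv_along p h ?l * ?l p)
        + (?z p \<bullet> deriv_along p h ?z + deriv_along p h ?z \<bullet> ?z p))) (at p within slab T)"
      unfolding e_def[abs_def]
      by (intro has_derivative_add has_derivative_mult has_derivative_inner has_deriv_along C1_defects p)
    from deriv_along_eq[OF p this] show ?thesis by (simp add: inner_commute)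
  qed
  have g_deriv: "deriv_along p h (g j) = 2 * (deriv_along p h ?l * (?z p \<bullet> cre_col j (\<mu> p)))
      + 2 * (?l p * (cre_col j (\<mu> p) \<bullet> deriv_along p h ?z)) + 2 * (?l p * (?z p \<bullet> cre_col j (deriv_along p h \<mu>)))"
    if p: "p \<in> slab T" for p h j
  proof -
    have "(g j has_derivative (\<lambda>h. 2 * (?l p * (?z p \<bullet> cre_col j (deriv_along p h \<mu>) + deriv_along p h ?z \<bullet> cre_col j (\<mu> p))
        + deriv_along p h ?l * (?z p \<bullet> cre_col j (\<mu> p))))) (at p within slab T)"
      unfolding g_def[abs_def]
      by (intro has_derivative_mult_right has_derivative_mult has_derivative_inner fock_has_derivative has_deriv_along C1_defects C1_all p)
    from deriv_along_eq[OF p this] show ?thesis by (simp add: inner_commute algebra_simps)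
  qed
  have growth: "deriv_along p (transport_dir p) e \<le> (\<Sum>j\<in>UNIV. deriv_along p (axis_dir j) (g j)) + (CARD('n) * B + 2 * K) * e p"
    if p: "p \<in> slab T" for p
  proof -
    let ?w = "\<Sum>i\<in>UNIV. grad_v p i i"
    note zeroth = shear_source_bounds[of "grad_v p" B "grad_d p", OF B(3)[OF p] B(4)[OF p]]
    define y where "y = - shear (grad_v p) (?z p) + source (grad_d p) (?z p) + ?w *\<^sub>R ?z p"
    have \<mu>_minors: "\<mu> p = \<tau> p *\<^sub>R minors (minor_field p)"
      using minor_defect_zero_iff[OF \<tau>[OF p]] minors[OF p] by simp
    have l_flow: "deriv_along p (transport_dir p) ?l = (\<Sum>j\<in>UNIV. cre_col j (\<mu> p) \<bullet> deriv_along p (axis_dir j) ?z)"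
      unfolding deriv_along_energy_defect[OF p]
      by (rule energy_defect_transport[OF \<mu>_transport[OF p] v_transport[OF p] d_transport[OF p]])
         (simp add: deriv_along_momentum_defect[OF p] grad_v_def grad_d_def dt_dx_deriv_along)
    have l_ex: "deriv_along p (axis_dir i) ?l = (\<Sum>\<alpha>\<in>UNIV. d \<alpha> p * grad_d p \<alpha> i) + (\<Sum>k\<in>UNIV. v k p * grad_v p i k)
        + \<mu> p \<bullet> deriv_along p (axis_dir i) \<mu>" for i
      unfolding deriv_along_energy_defect[OF p] by (simp add: grad_v_def grad_d_def dt_dx_deriv_along)
    have z_flow: "deriv_along p (transport_dir p) ?z = (\<Sum>i\<in>UNIV. deriv_along p (axis_dir i) ?l *\<^sub>R cre_col i (\<mu> p)) + y"
      unfolding deriv_along_momentum_defect[OF p] l_ex y_def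
      using momentum_defect_transport[OF \<mu>_transport[OF p] v_transport[OF p] d_transport[OF p] momentum_defect_def
          minors_imp_expansions(1)[OF \<mu>_minors] minors_imp_expansions(2)[OF \<mu>_minors]]
      by simp
    have "deriv_along p (transport_dir p) e = (\<Sum>j\<in>UNIV. deriv_along p (axis_dir j) (g j))
        - 2 * (?l p * (\<Sum>j\<in>UNIV. ?z p \<bullet> cre_col j (deriv_along p (axis_dir j) \<mu>))) + 2 * (?z p \<bullet> y)"
      unfolding e_deriv[OF p] g_deriv[OF p] l_flow z_flow
      by (simp add: sum.distrib inner_add_right inner_sum_right sum_distrib_left algebra_simps)
    moreover have "- 2 * (?l p * (\<Sum>j\<in>UNIV. ?z p \<bullet> cre_col j (deriv_along p (axis_dir j) \<mu>))) \<le> CARD('n) * B * e p"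
    proof -
      have "\<bar>\<Sum>j\<in>UNIV. ?z p \<bullet> cre_col j (deriv_along p (axis_dir j) \<mu>)\<bar> \<le> (\<Sum>j\<in>(UNIV::'n set). norm (?z p) * B)"
      proof (rule order_trans[OF sum_abs], rule sum_mono)
        fix j
        have "\<bar>?z p \<bullet> cre_col j (deriv_along p (axis_dir j) \<mu>)\<bar> \<le> norm (?z p) * norm (cre_col j (deriv_along p (axis_dir j) \<mu>))"
          by (rule Cauchy_Schwarz_ineq2)
        also have "\<dots> \<le> norm (?z p) * B"
          by (intro mult_left_mono order_trans[OF norm_fock_le(2) B(6)[OF p]]) simp
        finally show "\<bar>?z p \<bullet> cre_col j (deriv_along p (axis_dir j) \<mu>)\<bar> \<le> norm (?z p) * B" .
      qed
      then have "\<bar>?l p\<bar> * \<bar>\<Sum>j\<in>UNIV. ?z p \<bullet> cre_col j (deriv_along p (axis_dir j) \<mu>)\<bar> \<le> \<bar>?l p\<bar> * (CARD('n) * (norm (?z p) * B))"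
        by (intro mult_left_mono) auto
      moreover have "CARD('n) * B * (2 * (\<bar>?l p\<bar> * norm (?z p))) \<le> CARD('n) * B * e p"
        using B(1) amgm[of p] by (intro mult_left_mono) auto
      moreover have "- 2 * (?l p * (\<Sum>j\<in>UNIV. ?z p \<bullet> cre_col j (deriv_along p (axis_dir j) \<mu>)))
          \<le> 2 * (\<bar>?l p\<bar> * \<bar>\<Sum>j\<in>UNIV. ?z p \<bullet> cre_col j (deriv_along p (axis_dir j) \<mu>)\<bar>)"
        using abs_ge_minus_self[of "?l p * (\<Sum>j\<in>UNIV. ?z p \<bullet> cre_col j (deriv_along p (axis_dir j) \<mu>))"]
        by (simp add: abs_mult)
      ultimately show ?thesis by (simp add: mult_ac)
    qed
    moreover have "2 * (?z p \<bullet> y) \<le> 2 * K * e p"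
    proof -
      have "norm (?w *\<^sub>R ?z p) \<le> CARD('n) * B * norm (?z p)"
        using mult_right_mono[OF zeroth(3) norm_ge_zero[of "?z p"]] by simp
      moreover have "norm y \<le> norm (shear (grad_v p) (?z p)) + norm (source (grad_d p) (?z p)) + norm (?w *\<^sub>R ?z p)"
        using norm_triangle_ineq[of "- shear (grad_v p) (?z p) + source (grad_d p) (?z p)" "?w *\<^sub>R ?z p"]
          norm_triangle_ineq[of "- shear (grad_v p) (?z p)" "source (grad_d p) (?z p)"]
        unfolding y_def norm_minus_cancel by linarith
      ultimately have "norm y \<le> K * norm (?z p)"
        using zeroth(1,2)[of "?z p"]
        by (simp add: K_def distrib_right)
      then have "norm (?z p) * norm y \<le> norm (?z p) * (K * norm (?z p))" by (intro mult_left_mono) auto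
      moreover have "?z p \<bullet> y \<le> norm (?z p) * norm y" by (rule norm_cauchy_schwarz)
      moreover have "norm (?z p) * (K * norm (?z p)) = K * (?z p \<bullet> ?z p)"
        by (simp add: dot_square_norm power2_eq_square)
      moreover have "K * (?z p \<bullet> ?z p) \<le> K * e p"
        using B(1) by (intro mult_left_mono) (auto simp: e_def K_def)
      ultimately show ?thesis by simp
    qed
    ultimately show ?thesis by (simp add: algebra_simps)
  qed
  have "e p0 = 0"
  proof (rule transport_energy_uniqueness[OF T C1_e C1_g C1_fields(3) e_nonneg _ B(2) _ _ _ p0,
        where C = "CARD('n) * B + 2 * K"])
    show "\<bar>g j p\<bar> \<le> B * e p" if p: "p \<in> slab T" for j p
    proof -
      have "\<bar>?z p \<bullet> cre_col j (\<mu> p)\<bar> \<le> norm (?z p) * B"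
        by (rule order_trans[OF Cauchy_Schwarz_ineq2])
           (intro mult_left_mono order_trans[OF norm_fock_le(2) B(5)[OF p]], simp)
      then have "\<bar>g j p\<bar> \<le> 2 * (\<bar>?l p\<bar> * (norm (?z p) * B))"
        by (simp add: g_def abs_mult mult_left_mono)
      also have "\<dots> = B * (2 * (\<bar>?l p\<bar> * norm (?z p)))" by simp
      also have "\<dots> \<le> B * e p" using B(1) amgm[of p] by (rule mult_left_mono[rotated])
      finally show ?thesis .
    qed
    show "dt T e p + (\<Sum>j\<in>UNIV. v j p * dx T j e p)
        \<le> (\<Sum>j\<in>UNIV. dx T j (g j) p) + (CARD('n) * B + 2 * K) * e p" if p: "p \<in> slab T" for p
      using growth[OF p] unfolding dt_dx_deriv_along by (simp add: deriv_along_transport[OF C1_e p])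
    show "\<bar>dx T j (v j) p\<bar> \<le> B" if "p \<in> slab T" for j p
      using B(3)[OF that, of j j] by (simp add: grad_v_def)
    show "e (0, x) = 0" for x by (simp add: e_def init)
  qed
  moreover have "0 \<le> ?l p0 * ?l p0" "0 \<le> ?z p0 \<bullet> ?z p0" by simp_all
  ultimately have "?l p0 * ?l p0 = 0" "?z p0 \<bullet> ?z p0 = 0" unfolding e_def by linarith+
  then show ?thesis by simp
qed

end

theorem proposition3p4:
  fixes T :: real
    and \<tau> :: "'n::{finite,linorder} field"
    and d :: "'m::{finite,linorder} \<Rightarrow> 'n field"
    and v :: "'n \<Rightarrow> 'n field"
    and m :: "'m set \<Rightarrow> 'n set \<Rightarrow> 'n field"
  assumes "0 < T"
    and "smooth_solution_N T \<tau> d v m"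
    and "\<And>t x. t \<in> {0..T} \<Longrightarrow> \<tau> (t, x) > 0"
    and "\<And>x. constraints \<tau> d v m (0, x)"
  shows "\<forall>t\<in>{0..T}. \<forall>x. constraints \<tau> d v m (t, x)"
proof -
  interpret smooth_solution T \<tau> d v m by unfold_locales (fact assms(1,2))+
  have \<tau>: "\<tau> p \<noteq> 0" if "p \<in> slab T" for p
    using assms(3)[of "fst p" "snd p"] that by (simp add: slab_iff)
  have init: "minor_defect j (0, x) = 0" "energy_defect (0, x) = 0" "momentum_defect (0, x) = 0" for j x
    using constraints_iff_defects[OF \<tau>, of "(0, x)"] assms(1,4) by (simp_all add: slab_iff)
  have minors: "minor_defect j p = 0" if "p \<in> slab T" for j p
    using minor_defect_vanishes[OF init(1) that] .
  have "constraints \<tau> d v m p" if p: "p \<in> slab T" for p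
    using constraints_iff_defects[OF \<tau>[OF p]] minors[OF p]
      energy_momentum_defects_vanish[OF \<tau> minors init(2,3) p] by simp
  then show ?thesis by (simp add: slab_iff)
qed

end
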